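(* Let $D$ be a (nonempty) skew Young diagram, viewed as a finite set of cells $(i,j)$ ($i$ = row index, $j$ = column index), and let $\mathbf{k}=(k_{ij})_{(i,j)\in D}$ be a diagonally constant index on $D$. Let $N$ be a positive integer. Then \[\zeta_{<N}(\mathbf{k})=\zeta^\flat_{<N}(\mathbf{k}),\] where \[\zeta_{<N}(\mathbf{k})=\sum_{(m_{ij})\in\mathrm{SSYT}_{<N}(D)}\ \prod_{(i,j)\in D}\frac{1}{m_{ij}^{k_{ij}}}\] and \[\zeta^\flat_{<N}(\mathbf{k})=\sum\ \prod_{p=p_0}^{p_1}\frac{1}{\Pi(\mathbf{N}-\mathbf{n}^{(1)}_p)\,\Pi(\mathbf{n}^{(2)}_p)\cdots\Pi(\mathbf{n}^{(k_p)}_p)},\] the last sum running over all families of tuples $\mathbf{n}^{(l)}_p\in[1,N-1]^{J_p}$ ($p_0\le p\le p_1$, $1\le l\le k_p$) such that $\mathbf{n}^{(l)}_p\trianglelefteq\mathbf{n}^{(l+1)}_p$ for all $p$ and all $1\le l<k_p$, and $\mathbf{n}^{(k_p)}_p\vartriangleleft\mathbf{n}^{(1)}_{p+1}$ for all $p_0\le p<p_1$.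
   Context: $[a,b]=\{x\in\mathbb{Z}: a\le x\le b\}$ (possibly empty); such sets are called intervals. An index on $D$ is a tuple of positive integers indexed by the cells of $D$; it is diagonally constant if $k_{ij}$ depends only on $i-j$. $\mathrm{SSYT}_{<N}(D)$ is the set of semi-standard Young tableaux on $D$ with entries in $[1,N-1]$, i.e. fillings $(m_{ij})$ with $m_{ij}\le m_{i(j+1)}$ whenever $(i,j),(i,j+1)\in D$ and $m_{ij}<m_{(i+1)j}$ whenever $(i,j),(i+1,j)\in D$. For $p\in\mathbb{Z}$ let $D_p=\{(i,j)\in D: i-j=p\}$, $p_0=\min\{p: D_p\neq\emptyset\}$, $p_1=\max\{p:D_p\ne\emptyset\}$, $k_p=k_{ij}$ for any $(i,j)\in D_p$, with the convention $k_p=1$ if $D_p=\emptyset$, and $J_p=\{j\in\mathbb{Z}:(j+p,j)\in D\}$ (an interval). For a tuple $\mathbf{m}=(m_j)_{j\in J}$ let $\Pi(\mathbf{m})=\prod_{j\in J}m_j$ (empty product $=1$) and $\mathbf{N}-\mathbf{m}=(N-m_j)_{j\in J}$. For tuples $\mathbf{m}=(m_j)_{j\in J}$, $\mathbf{n}=(n_j)_{j\in J'}$ indexed by intervals $J,J'$: $\mathbf{m}\vartriangleleft\mathbf{n}$ means $m_j<n_j$ whenever $j\in J\cap J'$, and $n_{j-1}\le m_j$ whenever $j\in J$ and $j-1\in J'$; $\mathbf{m}\trianglelefteq\mathbf{n}$ means $m_j\le n_j$ whenever $j\in J\cap J'$, and $n_{j-1}<m_j$ whenever $j\in J$ and $j-1\in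 J'$. (Note $\trianglelefteq$ is not "$\vartriangleleft$ or equal".) *)

theory Defs
  imports Complex_Main "HOL-Library.FuncSet"
begin

type_synonym cell = "int \<times> int"

text \<open>An integer partition is given by its sequence of parts, padded with zeros:
  \<open>\<lambda> i\<close> is the length of the row with number \<open>i + 1\<close>.\<close>

definition is_partition :: "(nat \<Rightarrow> nat) \<Rightarrow> bool" where
  "is_partition la \<longleftrightarrow> decseq la \<and> finite {i. la i \<noteq> 0}"

definition skew_cells :: "(nat \<Rightarrow> nat) \<Rightarrow> (nat \<Rightarrow> nat) \<Rightarrow> cell set" where
  "skew_cells la mu = {(int i + 1, int j) | i j. mu i < j \<and> j \<le> la i}"

definition skew_diagram :: "cell set \<Rightarrow> bool" where
  "skew_diagram D \<longleftrightarrow>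
     (\<exists>la mu. is_partition la \<and> is_partition mu \<and> (\<forall>i. mu i \<le> la i) \<and> D = skew_cells la mu)"

text \<open>Indices, fillings and tuples are functions on cells or integers. An index is only
  constrained on \<open>D\<close>; fillings and tuples, which are summed over, are extensional, so that each is
  counted once.\<close>

definition is_index :: "cell set \<Rightarrow> (cell \<Rightarrow> nat) \<Rightarrow> bool" where
  "is_index D k \<longleftrightarrow> (\<forall>c\<in>D. 0 < k c)"

definition diag_const :: "cell set \<Rightarrow> (cell \<Rightarrow> nat) \<Rightarrow> bool" where
  "diag_const D k \<longleftrightarrow>
     (\<forall>i j i' j'. (i, j) \<in> D \<longrightarrow> (i', j') \<in> D \<longrightarrow> i - j = i' - j' \<longrightarrow> k (i, j) = k (i', j'))"

definition SSYT :: "nat \<Rightarrow> cell set \<Rightarrow> (cell \<Rightarrow> int) set" where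
  "SSYT N D = {m \<in> D \<rightarrow>\<^sub>E {1..int N - 1}.
     (\<forall>i j. (i, j) \<in> D \<longrightarrow> (i, j + 1) \<in> D \<longrightarrow> m (i, j) \<le> m (i, j + 1)) \<and>
     (\<forall>i j. (i, j) \<in> D \<longrightarrow> (i + 1, j) \<in> D \<longrightarrow> m (i, j) < m (i + 1, j))}"

definition zeta_lt :: "nat \<Rightarrow> cell set \<Rightarrow> (cell \<Rightarrow> nat) \<Rightarrow> real" where
  "zeta_lt N D k = (\<Sum>m\<in>SSYT N D. \<Prod>c\<in>D. 1 / of_int (m c) ^ k c)"

definition diag :: "cell set \<Rightarrow> int \<Rightarrow> cell set" where
  "diag D p = {(i, j) \<in> D. i - j = p}"

definition p_min :: "cell set \<Rightarrow> int" where
  "p_min D = Min {p. diag D p \<noteq> {}}"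

definition p_max :: "cell set \<Rightarrow> int" where
  "p_max D = Max {p. diag D p \<noteq> {}}"

definition diag_index :: "cell set \<Rightarrow> (cell \<Rightarrow> nat) \<Rightarrow> int \<Rightarrow> nat" where
  "diag_index D k p = (if diag D p = {} then 1 else k (SOME c. c \<in> diag D p))"

definition J :: "cell set \<Rightarrow> int \<Rightarrow> int set" where
  "J D p = {j. (j + p, j) \<in> D}"

text \<open>The two relations between a tuple \<open>m\<close> indexed by \<open>A\<close> and a tuple \<open>n\<close> indexed by \<open>B\<close>. The strict
  and weak inequalities are exchanged between them, so the second is not the reflexive closure of
  the first.\<close>

definition tri_lt :: "int set \<Rightarrow> (int \<Rightarrow> int) \<Rightarrow> int set \<Rightarrow> (int \<Rightarrow> int) \<Rightarrow> bool" where
  "tri_lt A m B n \<longleftrightarrow>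
     (\<forall>j. j \<in> A \<inter> B \<longrightarrow> m j < n j) \<and> (\<forall>j. j \<in> A \<longrightarrow> j - 1 \<in> B \<longrightarrow> n (j - 1) \<le> m j)"

definition tri_le :: "int set \<Rightarrow> (int \<Rightarrow> int) \<Rightarrow> int set \<Rightarrow> (int \<Rightarrow> int) \<Rightarrow> bool" where
  "tri_le A m B n \<longleftrightarrow>
     (\<forall>j. j \<in> A \<inter> B \<longrightarrow> m j \<le> n j) \<and> (\<forall>j. j \<in> A \<longrightarrow> j - 1 \<in> B \<longrightarrow> n (j - 1) < m j)"

text \<open>A family of tuples is a function \<open>n\<close>, where \<open>n (p, l)\<close> is the tuple with lower index \<open>p\<close> and
  upper index \<open>l\<close>.\<close>

definition flat_families ::
    "nat \<Rightarrow> cell set \<Rightarrow> (cell \<Rightarrow> nat) \<Rightarrow> (int \<times> nat \<Rightarrow> int \<Rightarrow> int) set" where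
  "flat_families N D k =
     {n \<in> Pi\<^sub>E (SIGMA p:{p_min D..p_max D}. {1..diag_index D k p})
            (\<lambda>(p, l). J D p \<rightarrow>\<^sub>E {1..int N - 1}).
       (\<forall>p\<in>{p_min D..p_max D}. \<forall>l\<in>{1..<diag_index D k p}.
          tri_le (J D p) (n (p, l)) (J D p) (n (p, l + 1))) \<and>
       (\<forall>p\<in>{p_min D..<p_max D}.
          tri_lt (J D p) (n (p, diag_index D k p)) (J D (p + 1)) (n (p + 1, 1)))}"

definition zeta_flat :: "nat \<Rightarrow> cell set \<Rightarrow> (cell \<Rightarrow> nat) \<Rightarrow> real" where
  "zeta_flat N D k =
     (\<Sum>n\<in>flat_families N D k. \<Prod>p\<in>{p_min D..p_max D}.
        1 / ((\<Prod>j\<in>J D p. of_int (int N - n (p, 1) j)) *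
             (\<Prod>l\<in>{2..diag_index D k p}. \<Prod>j\<in>J D p. of_int (n (p, l) j))))"

end

theory Submission
  imports Defs "Jordan_Normal_Form.Determinant"
begin

text \<open>Put \<open>f\<^sub>m(x) = (x choose m) / (N - 1 choose m)\<close>, a discrete analogue of \<open>t\<^sup>m\<close> at \<open>t = x / N\<close>.
  The discrete counterparts of \<open>t\<^sup>m / m = \<integral> t\<^sup>m dt / t\<close> and
  \<open>\<Sum>\<^sub>a\<^sub>>\<^sub>m t\<^sup>a / a = \<integral> t\<^sup>m dt / (1 - t)\<close> are the identities
  \<open>f\<^sub>a(x) - f\<^sub>a(x - 1) = (a / x) f\<^sub>a(x)\<close> and
  \<open>(f\<^sub>a(x) - f\<^sub>a(x - 1)) / a = (f\<^sub>a\<^sub>-\<^sub>1(x - 1) - f\<^sub>a(x - 1)) / (N - x)\<close>.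
  A whole diagonal of the tableau is handled at once by the determinant
  \<open>det (f\<^sub>m\<^sub>i(x\<^sub>j) - f\<^sub>m\<^sub>i(x\<^sub>j\<^sub>-\<^sub>1))\<close>, which is multilinear in rows and columns: the first identity,
  summed over intervals, trades a factor \<open>1 / \<Pi>(m)\<close> for a sum over tuples interlacing with \<open>x\<close> in
  the sense of \<open>\<unlhd>\<close>, and the second one replaces the sum over the next diagonal
  by a sum over tuples weighted by \<open>1 / \<Pi>(N - n)\<close>. Starting from the last diagonal and moving
  up, every diagonal of \<open>\<zeta>\<close> is converted into the corresponding tuples of \<open>\<zeta>\<^sup>\<flat>\<close>; beyond both ends
  of the diagram the determinant is 1.\<close>

section \<open>Determinants indexed by integer intervals\<close>

text \<open>The Leibniz formula over an arbitrary set of integers: neighbouring diagonals keep the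
  column labels of their cells, and empty diagonals need no special case.\<close>

definition idet :: "int set \<Rightarrow> (int \<Rightarrow> int \<Rightarrow> real) \<Rightarrow> real" where
  "idet A M = (\<Sum>p | p permutes A. of_int (sign p) * (\<Prod>i\<in>A. M i (p i)))"

lemma idet_cong:
  assumes "\<And>i j. i \<in> A \<Longrightarrow> j \<in> A \<Longrightarrow> M i j = M' i j"
  shows "idet A M = idet A M'"
  unfolding idet_def
  by (intro sum.cong refl arg_cong2[where f = "(*)"] prod.cong assms) (auto simp: permutes_in_image)

lemma idet_empty [simp]: "idet {} M = 1"
  by (simp add: idet_def)

lemma idet_singleton [simp]: "idet {a} M = M a a"
  by (simp add: idet_def)

lemma idet_transpose:
  assumes "finite A"
  shows "idet A (\<lambda>i j. M j i) = idet A M"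
proof -
  have "idet A M = (\<Sum>p | p permutes A. of_int (sign (inv_into UNIV p)) * (\<Prod>i\<in>A. M i (inv_into UNIV p i)))"
    unfolding idet_def by (rule sum_permutations_inverse)
  also have "\<dots> = idet A (\<lambda>i j. M j i)"
    unfolding idet_def
  proof (rule sum.cong)
    fix p assume "p \<in> {p. p permutes A}"
    hence p: "p permutes A" by simp
    have "(\<Prod>i\<in>A. M i (inv_into UNIV p i)) = (\<Prod>i\<in>A. M (p i) (inv_into UNIV p (p i)))"
      by (rule prod.reindex_bij_betw[OF permutes_imp_bij[OF p], symmetric])
    also have "\<dots> = (\<Prod>i\<in>A. M (p i) i)"
      using permutes_inverses[OF p] by simp
    finally show "of_int (sign (inv_into UNIV p)) * (\<Prod>i\<in>A. M i (inv_into UNIV p i)) =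
        of_int (sign p) * (\<Prod>i\<in>A. M (p i) i)"
      using p assms by (metis permutation_permutes sign_inverse)
  qed simp
  finally show ?thesis ..
qed

text \<open>Multilinearity in the rows: expanding selects one \<open>c i\<close> for each row, and
  these selections are extensional tuples like those the zeta sums run over.\<close>

lemma idet_sum_rows:
  assumes "finite A" "\<And>i. i \<in> A \<Longrightarrow> finite (C i)"
  shows "idet A (\<lambda>i j. \<Sum>c\<in>C i. v i c * g c j) =
    (\<Sum>c\<in>Pi\<^sub>E A C. (\<Prod>i\<in>A. v i (c i)) * idet A (\<lambda>i j. g (c i) j))"
proof -
  have "idet A (\<lambda>i j. \<Sum>c\<in>C i. v i c * g c j) =
      (\<Sum>p | p permutes A. \<Sum>c\<in>Pi\<^sub>E A C. of_int (sign p) * (\<Prod>i\<in>A. v i (c i) * g (c i) (p i)))"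
    unfolding idet_def using assms by (simp add: prod_sum_PiE sum_distrib_left)
  also have "\<dots> = (\<Sum>c\<in>Pi\<^sub>E A C. \<Sum>p | p permutes A. of_int (sign p) * (\<Prod>i\<in>A. v i (c i) * g (c i) (p i)))"
    by (rule sum.swap)
  also have "\<dots> = (\<Sum>c\<in>Pi\<^sub>E A C. (\<Prod>i\<in>A. v i (c i)) * idet A (\<lambda>i j. g (c i) j))"
    unfolding idet_def by (simp add: prod.distrib sum_distrib_left mult_ac)
  finally show ?thesis .
qed

lemma idet_sum_cols:
  assumes "finite A" "\<And>j. j \<in> A \<Longrightarrow> finite (C j)"
  shows "idet A (\<lambda>i j. \<Sum>c\<in>C j. v j c * g i c) =
    (\<Sum>c\<in>Pi\<^sub>E A C. (\<Prod>j\<in>A. v j (c j)) * idet A (\<lambda>i j. g i (c j)))"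
proof -
  have "idet A (\<lambda>i j. \<Sum>c\<in>C j. v j c * g i c) = idet A (\<lambda>j i. \<Sum>c\<in>C j. v j c * g i c)"
    by (rule idet_transpose[OF assms(1), symmetric])
  also have "\<dots> = (\<Sum>c\<in>Pi\<^sub>E A C. (\<Prod>j\<in>A. v j (c j)) * idet A (\<lambda>j i. g i (c j)))"
    by (rule idet_sum_rows[OF assms])
  also have "\<dots> = (\<Sum>c\<in>Pi\<^sub>E A C. (\<Prod>j\<in>A. v j (c j)) * idet A (\<lambda>i j. g i (c j)))"
    using idet_transpose[OF assms(1)] by (intro sum.cong refl arg_cong2[where f = "(*)"]) fast
  finally show ?thesis .
qed

lemma idet_scale_rows:
  "idet A (\<lambda>i j. v i * M i j) = (\<Prod>i\<in>A. v i) * idet A M"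
  unfolding idet_def by (simp add: prod.distrib sum_distrib_left mult_ac)

section \<open>Row and column differences, bordering\<close>

lemma idet_eq_det:
  "idet {s..<s + int n} M = det (mat n n (\<lambda>(i, j). M (s + int i) (s + int j)))"
proof -
  let ?f = "\<lambda>i::nat. s + int i" and ?g = "\<lambda>k. nat (k - s)"
  let ?A = "{0..<n}" and ?B = "{s..<s + int n}"
  have f: "bij_betw ?f ?A ?B"
    by (rule bij_betw_byWitness[where f' = ?g]) auto
  have g: "bij_betw ?g ?B ?A"
    by (rule bij_betw_byWitness[where f' = ?f]) auto
  have "det (mat n n (\<lambda>(i, j). M (s + int i) (s + int j))) =
      (\<Sum>p | p permutes ?A. of_int (sign p) * (\<Prod>i\<in>?A. M (?f i) (?f (p i))))"
    unfolding det_def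
    by (auto intro!: sum.cong prod.cong simp: permutes_in_image)
  also have "\<dots> = idet ?B M"
    unfolding idet_def
  proof (rule sum.reindex_bij_witness[where i = "map_permutation ?B ?g" and j = "map_permutation ?A ?f"])
    fix p assume "p \<in> {p. p permutes ?A}"
    hence p: "p permutes ?A" by simp
    show "map_permutation ?B ?g (map_permutation ?A ?f p) = p"
      by (rule map_permutation_compose_inv[OF f p]) simp
    show "map_permutation ?A ?f p \<in> {p. p permutes ?B}"
      using map_permutation_permutes[OF f p] by simp
    have "(\<Prod>k\<in>?B. M k (map_permutation ?A ?f p k)) =
        (\<Prod>i\<in>?A. M (?f i) (map_permutation ?A ?f p (?f i)))"
      by (rule prod.reindex_bij_betw[OF f, symmetric])
    also have "\<dots> = (\<Prod>i\<in>?A. M (?f i) (?f (p i)))"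
      using bij_betw_imp_inj_on[OF f] by (intro prod.cong refl) (subst map_permutation_apply, auto)
    finally show "of_int (sign (map_permutation ?A ?f p)) * (\<Prod>k\<in>?B. M k (map_permutation ?A ?f p k))
        = of_int (sign p) * (\<Prod>i\<in>?A. M (?f i) (?f (p i)))"
      using sign_map_permutation[OF bij_betw_imp_inj_on[OF f] p] by simp
  next
    fix p assume "p \<in> {p. p permutes ?B}"
    hence p: "p permutes ?B" by simp
    show "map_permutation ?A ?f (map_permutation ?B ?g p) = p"
      by (rule map_permutation_compose_inv[OF g p]) auto
    show "map_permutation ?B ?g p \<in> {p. p permutes ?A}"
      using map_permutation_permutes[OF g p] by simp
  qed
  finally show ?thesis ..
qed

text \<open>Unitriangular: multiplication by it subtracts from each row the next one (on the left)
  or from each column the preceding one (on the right), without changing the determinant.\<close>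

definition bidiag :: "nat \<Rightarrow> real mat" where
  "bidiag n = mat n n (\<lambda>(i, j). if i = j then 1 else if j = Suc i then -1 else 0)"

lemma bidiag_carrier [simp]: "bidiag n \<in> carrier_mat n n"
  by (simp add: bidiag_def)

lemma det_bidiag: "det (bidiag n) = 1"
proof -
  have "det (bidiag n) = prod_list (diag_mat (bidiag n))"
    by (rule det_upper_triangular[of _ n]) (auto intro!: upper_triangularI simp: bidiag_def)
  also have "diag_mat (bidiag n) = map (\<lambda>_. 1) [0..<n]"
    by (auto simp: diag_mat_def bidiag_def intro!: map_cong)
  also have "prod_list \<dots> = (1::real)"
    by (induction n) auto
  finally show ?thesis .
qed

lemma idet_row_differences:
  "idet {s..<s + int n} M =
   idet {s..<s + int n} (\<lambda>i j. M i j - (if i + 1 < s + int n then M (i + 1) j else 0))"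
proof -
  define A where "A = mat n n (\<lambda>(i, j). M (s + int i) (s + int j))"
  have A: "A \<in> carrier_mat n n" by (simp add: A_def)
  have "bidiag n * A = mat n n (\<lambda>(i, j). (\<lambda>i j. M i j - (if i + 1 < s + int n then M (i + 1) j else 0))
      (s + int i) (s + int j))"
  proof (rule eq_matI)
    fix i j assume "i < dim_row (mat n n (\<lambda>(i, j). (\<lambda>i j. M i j - (if i + 1 < s + int n then M (i + 1) j else 0))
      (s + int i) (s + int j)))" "j < dim_col (mat n n (\<lambda>(i, j). (\<lambda>i j. M i j - (if i + 1 < s + int n then M (i + 1) j else 0))
      (s + int i) (s + int j)))"
    hence ij: "i < n" "j < n" by auto
    have "(bidiag n * A) $$ (i, j) = (\<Sum>k\<in>{0..<n}. bidiag n $$ (i, k) * A $$ (k, j))"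
      using ij A by (simp add: scalar_prod_def bidiag_def)
    also have "\<dots> = (\<Sum>k\<in>{0..<n}. (if k = i then A $$ (k, j) else 0) - (if k = Suc i then A $$ (k, j) else 0))"
      using ij by (intro sum.cong refl) (auto simp: bidiag_def)
    also have "\<dots> = A $$ (i, j) - (if Suc i < n then A $$ (Suc i, j) else 0)"
      using ij by (simp add: sum_subtractf)
    finally show "(bidiag n * A) $$ (i, j) = mat n n (\<lambda>(i, j). (\<lambda>i j. M i j - (if i + 1 < s + int n then M (i + 1) j else 0))
      (s + int i) (s + int j)) $$ (i, j)"
      using ij by (auto simp: A_def algebra_simps)
  qed (auto simp: A_def bidiag_def)
  moreover have "det (bidiag n * A) = det A"
    using det_mult[OF bidiag_carrier A] by (simp add: det_bidiag)
  ultimately show ?thesis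
    unfolding idet_eq_det A_def by simp
qed

lemma idet_col_differences:
  "idet {s..<s + int n} M =
   idet {s..<s + int n} (\<lambda>i j. M i j - (if s < j then M i (j - 1) else 0))"
proof -
  define A where "A = mat n n (\<lambda>(i, j). M (s + int i) (s + int j))"
  define B where "B = mat n n (\<lambda>(i, j). (\<lambda>i j. M i j - (if s < j then M i (j - 1) else 0))
      (s + int i) (s + int j))"
  have A: "A \<in> carrier_mat n n" by (simp add: A_def)
  have "A * bidiag n = B"
  proof (rule eq_matI)
    fix i j assume "i < dim_row B" "j < dim_col B"
    hence ij: "i < n" "j < n" by (auto simp: B_def)
    have "(A * bidiag n) $$ (i, j) = (\<Sum>k\<in>{0..<n}. A $$ (i, k) * bidiag n $$ (k, j))"
      using ij A by (simp add: scalar_prod_def bidiag_def)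
    also have "\<dots> = (\<Sum>k\<in>{0..<n}. (if k = j then A $$ (i, k) else 0) -
        (if 0 < j \<and> k = j - 1 then A $$ (i, k) else 0))"
      using ij by (intro sum.cong refl) (auto simp: bidiag_def)
    also have "\<dots> = A $$ (i, j) - (if 0 < j then A $$ (i, j - 1) else 0)"
      using ij by (cases "0 < j") (auto simp add: sum_subtractf)
    finally show "(A * bidiag n) $$ (i, j) = B $$ (i, j)"
      using ij by (auto simp: A_def B_def of_nat_diff algebra_simps)
  qed (auto simp: A_def B_def bidiag_def)
  moreover have "det (A * bidiag n) = det A"
    using det_mult[OF A bidiag_carrier] by (simp add: det_bidiag)
  ultimately show ?thesis
    unfolding idet_eq_det A_def B_def by simp
qed

text \<open>Laplace expansion along the last column, which is a unit vector.\<close>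

lemma idet_delete_last:
  assumes "M (s + int n) (s + int n) = 1" "\<And>i. s \<le> i \<Longrightarrow> i < s + int n \<Longrightarrow> M i (s + int n) = 0"
  shows "idet {s..<s + int (Suc n)} M = idet {s..<s + int n} M"
proof -
  define A where "A = mat (Suc n) (Suc n) (\<lambda>(i, j). M (s + int i) (s + int j))"
  have A: "A \<in> carrier_mat (Suc n) (Suc n)" by (simp add: A_def)
  have "det A = (\<Sum>i<Suc n. A $$ (i, n) * cofactor A i n)"
    by (rule laplace_expansion_column[OF A]) simp
  also have "\<dots> = cofactor A n n"
    using assms by (simp add: A_def)
  also have "\<dots> = det (mat_delete A n n)"
    by (simp add: cofactor_def)
  also have "mat_delete A n n = mat n n (\<lambda>(i, j). M (s + int i) (s + int j))"
    by (auto simp: mat_delete_def A_def)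
  finally show ?thesis unfolding idet_eq_det A_def .
qed

lemma idet_delete_first:
  assumes "M s s = 1" "\<And>j. s < j \<Longrightarrow> j \<le> s + int n \<Longrightarrow> M s j = 0"
  shows "idet {s..<s + int (Suc n)} M = idet {s + 1..<s + 1 + int n} M"
proof -
  define A where "A = mat (Suc n) (Suc n) (\<lambda>(i, j). M (s + int i) (s + int j))"
  have A: "A \<in> carrier_mat (Suc n) (Suc n)" by (simp add: A_def)
  have "det A = (\<Sum>j<Suc n. A $$ (0, j) * cofactor A 0 j)"
    by (rule laplace_expansion_row[OF A]) simp
  also have "\<dots> = (\<Sum>j\<in>{0}. A $$ (0, j) * cofactor A 0 j)"
    by (rule sum.mono_neutral_right) (use assms in \<open>auto simp: A_def\<close>)
  also have "\<dots> = det (mat_delete A 0 0)"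
    using assms by (simp add: cofactor_def A_def)
  also have "mat_delete A 0 0 = mat n n (\<lambda>(i, j). M (s + 1 + int i) (s + 1 + int j))"
    by (auto simp: mat_delete_def A_def algebra_simps)
  finally show ?thesis unfolding idet_eq_det A_def .
qed

text \<open>Either the row \<open>t\<close> just beyond the range vanishes, so that the last row may
  be differenced like the others, or the last column consists of ones. In that case differencing
  makes it a unit vector, and the last row and column drop out.\<close>

lemma idet_row_differences_border:
  assumes "s \<le> t" "t = t' \<and> (\<forall>j\<in>{s..<t}. M t j = 0) \<or> t = t' + 1 \<and> s < t \<and> (\<forall>i\<in>{s..<t}. M i (t - 1) = 1)"
  shows "idet {s..<t} M = idet {s..<t'} (\<lambda>i j. M i j - M (i + 1) j)"
proof -
  define n where "n = nat (t - s)"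
  have t: "t = s + int n" using assms by (simp add: n_def)
  have *: "idet {s..<t} M = idet {s..<t} (\<lambda>i j. M i j - (if i + 1 < t then M (i + 1) j else 0))"
    unfolding t by (rule idet_row_differences)
  from assms(2) show ?thesis
  proof
    assume A: "t = t' \<and> (\<forall>j\<in>{s..<t}. M t j = 0)"
    have "(if i + 1 < t then M (i + 1) j else 0) = M (i + 1) j" if "i \<in> {s..<t}" "j \<in> {s..<t}" for i j
    proof (cases "i + 1 < t")
      case False
      hence "i + 1 = t" using that by auto
      thus ?thesis using A that by auto
    qed simp
    hence "idet {s..<t} (\<lambda>i j. M i j - (if i + 1 < t then M (i + 1) j else 0)) =
        idet {s..<t} (\<lambda>i j. M i j - M (i + 1) j)"
      by (intro idet_cong) auto
    thus ?thesis using * A by simp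
  next
    assume A: "t = t' + 1 \<and> s < t \<and> (\<forall>i\<in>{s..<t}. M i (t - 1) = 1)"
    then obtain k where k: "n = Suc k" using t by (cases n) auto
    have t': "t' = s + int k" using A t k by simp
    have "idet {s..<t} M = idet {s..<s + int (Suc k)} (\<lambda>i j. M i j - (if i + 1 < t then M (i + 1) j else 0))"
      using * unfolding t k .
    also have "\<dots> = idet {s..<s + int k} (\<lambda>i j. M i j - (if i + 1 < t then M (i + 1) j else 0))"
      using A t k by (intro idet_delete_last) auto
    also have "\<dots> = idet {s..<t'} (\<lambda>i j. M i j - M (i + 1) j)"
      unfolding t' using A t' by (intro idet_cong) auto
    finally show ?thesis .
  qed
qed

text \<open>The mirror image at the upper left end: a vanishing column \<open>s - 1\<close>, or a
  first row of ones that differencing turns into a unit vector.\<close>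

lemma idet_col_differences_border:
  assumes "s' \<le> t" "s = s' \<and> (\<forall>i\<in>{s..<t}. M i (s - 1) = 0) \<or> s = s' + 1 \<and> s' < t \<and> (\<forall>j\<in>{s'..<t}. M s' j = 1)"
  shows "idet {s'..<t} M = idet {s..<t} (\<lambda>i j. M i j - M i (j - 1))"
proof -
  define n where "n = nat (t - s')"
  have t: "t = s' + int n" using assms by (simp add: n_def)
  have *: "idet {s'..<t} M = idet {s'..<t} (\<lambda>i j. M i j - (if s' < j then M i (j - 1) else 0))"
    unfolding t by (rule idet_col_differences)
  from assms(2) show ?thesis
  proof
    assume A: "s = s' \<and> (\<forall>i\<in>{s..<t}. M i (s - 1) = 0)"
    have "idet {s'..<t} (\<lambda>i j. M i j - (if s' < j then M i (j - 1) else 0)) =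
        idet {s'..<t} (\<lambda>i j. M i j - M i (j - 1))"
      using A by (intro idet_cong) force
    thus ?thesis using * A by simp
  next
    assume A: "s = s' + 1 \<and> s' < t \<and> (\<forall>j\<in>{s'..<t}. M s' j = 1)"
    then obtain k where k: "n = Suc k" using t by (cases n) auto
    have "idet {s'..<t} M = idet {s'..<s' + int (Suc k)} (\<lambda>i j. M i j - (if s' < j then M i (j - 1) else 0))"
      using * unfolding t k .
    also have "\<dots> = idet {s' + 1..<s' + 1 + int k} (\<lambda>i j. M i j - (if s' < j then M i (j - 1) else 0))"
      using A t k by (intro idet_delete_first) auto
    also have "\<dots> = idet {s..<t} (\<lambda>i j. M i j - M i (j - 1))"
    proof -
      have "{s..<t} = {s' + 1..<s' + 1 + int k}"
        using A t k by auto
      thus ?thesis by (auto intro!: idet_cong)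
    qed
    finally show ?thesis .
  qed
qed

section \<open>The connector\<close>

definition conn :: "nat \<Rightarrow> int \<Rightarrow> int \<Rightarrow> real" where
  "conn N m x = of_nat (nat x choose nat m) / of_nat ((N - 1) choose nat m)"

section \<open>Boundary values and difference identities of the connector\<close>

lemma conn_zero_left [simp]: "conn N 0 x = 1"
  by (simp add: conn_def)

lemma conn_zero_right: "1 \<le> m \<Longrightarrow> conn N m 0 = 0"
  by (simp add: conn_def binomial_eq_0)

lemma conn_last_right: "0 \<le> m \<Longrightarrow> m \<le> int N - 1 \<Longrightarrow> conn N m (int N - 1) = 1"
  by (simp add: conn_def nat_diff_distrib)

lemma conn_last_left: "0 \<le> x \<Longrightarrow> x < int N - 1 \<Longrightarrow> conn N (int N - 1) x = 0"
  by (simp add: conn_def binomial_eq_0)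

lemma int_sum_telescope:
  fixes f :: "int \<Rightarrow> real"
  assumes "x \<le> y"
  shows "(\<Sum>b\<in>{x<..y}. f b - f (b - 1)) = f y - f x"
  using assms
proof (induction y rule: int_ge_induct)
  case (step y)
  have "{x<..y + 1} = insert (y + 1) {x<..y}"
    using step by auto
  thus ?case using step by simp
qed simp

text \<open>Pascal's rule and absorption give \<open>a / c\<close> times the connector for a single
  step from \<open>c - 1\<close> to \<open>c\<close>; the steps telescope.\<close>

lemma conn_diff:
  assumes "1 \<le> a" "0 \<le> x" "x \<le> y"
  shows "conn N a y - conn N a x = (\<Sum>c\<in>{x<..y}. of_int a * (1 / of_int c * conn N a c))"
proof -
  have "conn N a c - conn N a (c - 1) = of_int a * (1 / of_int c * conn N a c)"
    if "c \<in> {x<..y}" for c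
  proof -
    define n where "n = nat (c - 1)"
    define k where "k = nat (a - 1)"
    have c: "c = int (Suc n)" and a: "a = int (Suc k)"
      using that assms by (auto simp: n_def k_def)
    have "real (Suc n) * real (n choose k) = real (Suc k) * real (Suc n choose Suc k)"
      using Suc_times_binomial[of k n] by (metis of_nat_mult)
    moreover have "real (Suc n choose Suc k) = real (n choose k) + real (n choose Suc k)"
      by simp
    ultimately have "real (Suc n choose Suc k) - real (n choose Suc k) =
        real (Suc k) / real (Suc n) * real (Suc n choose Suc k)"
      by (simp add: field_simps del: of_nat_Suc binomial_Suc_Suc)
    moreover have "nat c = Suc n" "nat (c - 1) = n" "nat a = Suc k"
      using c a by auto
    ultimately show ?thesis
      by (simp add: conn_def c a diff_divide_distrib[symmetric] del: of_nat_Suc binomial_Suc_Suc)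
  qed
  hence "(\<Sum>c\<in>{x<..y}. of_int a * (1 / of_int c * conn N a c)) =
      (\<Sum>c\<in>{x<..y}. conn N a c - conn N a (c - 1))"
    by (intro sum.cong refl) simp
  thus ?thesis
    using int_sum_telescope[OF assms(3), of "conn N a"] by simp
qed

text \<open>By Pascal's rule the left side is \<open>P / ((k + 1) * B)\<close> in the notation of
  the proof. Absorption expresses \<open>Q\<close> through \<open>P\<close> and \<open>B\<close>
  through \<open>A\<close>, so the difference on the right acquires the factor \<open>M - n\<close>,
  which equals \<open>N - b\<close> and cancels.\<close>

lemma conn_mixed_diff:
  assumes "1 \<le> a" "a \<le> int N - 1" "1 \<le> b" "b \<le> int N - 1"
  shows "1 / of_int a * (conn N a b - conn N a (b - 1)) =
    1 / of_int (int N - b) * (conn N (a - 1) (b - 1) - conn N a (b - 1))"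
proof -
  define M n k where "M = N - 1" and "n = nat (b - 1)" and "k = nat (a - 1)"
  have eq: "nat b = Suc n" "nat (b - 1) = n" "nat a = Suc k" "nat (a - 1) = k" "N - 1 = M"
    using assms by (auto simp: M_def n_def k_def)
  have less: "n < M" "k < M"
    using assms by (auto simp: M_def n_def k_def)
  have a: "real_of_int a = real k + 1" and Nb: "real_of_int (int N - b) = real M - real n"
    using assms by (auto simp: M_def n_def k_def of_nat_diff)
  have absorb: "(real k + 1) * real (m choose Suc k) = (real m - real k) * real (m choose k)" for m
  proof (cases "k \<le> m")
    case True
    have "Suc k * (m choose Suc k) = (m - k) * (m choose k)"
      using binomial_absorb_comp[of m k] binomial_absorption[of k m] by simp
    hence "real (Suc k) * real (m choose Suc k) = real (m - k) * real (m choose k)"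
      by (metis of_nat_mult)
    thus ?thesis using True by (simp add: of_nat_diff algebra_simps)
  qed (simp add: binomial_eq_0)
  define P Q A B where "P = real (n choose k)" and "Q = real (n choose Suc k)"
    and "A = real (M choose k)" and "B = real (M choose Suc k)"
  have pos: "A > 0" "B > 0"
    using less by (auto simp: A_def B_def)
  have Q: "Q = (real n - real k) * P / (real k + 1)" and B: "B = (real M - real k) * A / (real k + 1)"
    using absorb[of n] absorb[of M] by (auto simp: P_def Q_def A_def B_def field_simps)
  have "1 / (real k + 1) * ((P + Q) / B - Q / B) = 1 / (real M - real n) * (P / A - Q / B)"
  proof -
    have "P / A = P * (real M - real k) / ((real k + 1) * B)"
    proof -
      have "(real k + 1) * B = (real M - real k) * A" unfolding B by simp
      thus ?thesis using less by simp
    qed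
    moreover have "Q / B = P * (real n - real k) / ((real k + 1) * B)"
      unfolding Q by (simp add: field_simps)
    ultimately have "P / A - Q / B = P * (real M - real n) / ((real k + 1) * B)"
      by (simp add: diff_divide_distrib[symmetric] algebra_simps)
    thus ?thesis using pos less by (simp add: diff_divide_distrib[symmetric])
  qed
  thus ?thesis
    unfolding a Nb conn_def eq P_def Q_def A_def B_def by simp
qed

text \<open>The mixed identity summed over a rectangle: its left side telescopes in
  \<open>b\<close>, its right side in \<open>a\<close>. This exchanges the weights
  \<open>1 / a\<close> and \<open>1 / (N - b)\<close> in a single matrix entry.\<close>

lemma conn_double_sum:
  assumes "0 \<le> m" "m \<le> m'" "m' \<le> int N - 1" "0 \<le> x" "x \<le> y" "y \<le> int N - 1"
  shows "(\<Sum>a\<in>{m<..m'}. 1 / of_int a * (conn N a y - conn N a x)) =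
    (\<Sum>b\<in>{x<..y}. 1 / of_int (int N - b) * (conn N m (b - 1) - conn N m' (b - 1)))"
proof -
  have "(\<Sum>a\<in>{m<..m'}. 1 / of_int a * (conn N a y - conn N a x)) =
      (\<Sum>a\<in>{m<..m'}. \<Sum>b\<in>{x<..y}. 1 / of_int a * (conn N a b - conn N a (b - 1)))"
    unfolding sum_distrib_left[symmetric] int_sum_telescope[OF assms(5)] ..
  also have "\<dots> = (\<Sum>a\<in>{m<..m'}. \<Sum>b\<in>{x<..y}.
      1 / of_int (int N - b) * (conn N (a - 1) (b - 1) - conn N a (b - 1)))"
    using assms by (intro sum.cong refl conn_mixed_diff) auto
  also have "\<dots> = (\<Sum>b\<in>{x<..y}. 1 / of_int (int N - b) *
      - (\<Sum>a\<in>{m<..m'}. conn N a (b - 1) - conn N (a - 1) (b - 1)))"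
    by (subst sum.swap) (simp add: sum_distrib_left sum_negf[symmetric])
  also have "\<dots> = (\<Sum>b\<in>{x<..y}. 1 / of_int (int N - b) * (conn N m (b - 1) - conn N m' (b - 1)))"
    by (subst int_sum_telescope[OF assms(2), of "\<lambda>a. conn N a _"]) simp
  finally show ?thesis .
qed

section \<open>Transport relations for connector determinants\<close>

definition tuples :: "nat \<Rightarrow> int set \<Rightarrow> (int \<Rightarrow> int) set" where
  "tuples N A = A \<rightarrow>\<^sub>E {1..int N - 1}"

text \<open>Columns stand for the gaps of \<open>x\<close>, which must therefore have a meaningful
  value just left of \<open>A\<close> as well.\<close>

definition cdet :: "nat \<Rightarrow> int set \<Rightarrow> (int \<Rightarrow> int) \<Rightarrow> (int \<Rightarrow> int) \<Rightarrow> real" where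
  "cdet N A m x = idet A (\<lambda>i j. conn N (m i) (x j) - conn N (m i) (x (j - 1)))"

definition grid :: "nat \<Rightarrow> int set \<Rightarrow> (int \<Rightarrow> int) \<Rightarrow> bool" where
  "grid N A x \<longleftrightarrow> (\<forall>j\<in>A. 0 \<le> x (j - 1) \<and> x (j - 1) \<le> x j \<and> x j \<le> int N - 1)"

text \<open>A common form for \<open>tri_le\<close> and \<open>tri_lt\<close>: conditions absent at
  the ends are encoded by suitable values of \<open>x\<close> there.\<close>

definition between :: "int set \<Rightarrow> (int \<Rightarrow> int) \<Rightarrow> (int \<Rightarrow> int) \<Rightarrow> bool" where
  "between A x c \<longleftrightarrow> (\<forall>j\<in>A. x (j - 1) < c j \<and> c j \<le> x j)"

lemma tuplesD: "c \<in> tuples N A \<Longrightarrow> j \<in> A \<Longrightarrow> 1 \<le> c j \<and> c j \<le> int N - 1"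
  by (auto simp: tuples_def)

lemma finite_tuples [simp]: "finite A \<Longrightarrow> finite (tuples N A)"
  by (simp add: tuples_def finite_PiE)

lemma between_tuples_eq:
  assumes "grid N A x"
  shows "{c \<in> tuples N A. between A x c} = Pi\<^sub>E A (\<lambda>j. {x (j - 1)<..x j})"
  using assms unfolding tuples_def between_def grid_def PiE_def Pi_def by force

text \<open>\<open>conn_diff\<close> in every entry produces a factor \<open>m i\<close> in row
  \<open>i\<close>, which cancels the weight; what remains is expanded along the columns.\<close>

lemma cdet_col_transport:
  assumes "finite A" "grid N A x" "\<And>i. i \<in> A \<Longrightarrow> 1 \<le> m i"
  shows "(\<Prod>i\<in>A. 1 / of_int (m i)) * cdet N A m x =
    (\<Sum>c | c \<in> tuples N A \<and> between A x c.
      (\<Prod>j\<in>A. 1 / of_int (c j)) * idet A (\<lambda>i j. conn N (m i) (c j)))"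
proof -
  have "cdet N A m x =
      idet A (\<lambda>i j. of_int (m i) * (\<Sum>c\<in>{x (j - 1)<..x j}. 1 / of_int c * conn N (m i) c))"
    unfolding cdet_def using assms
    by (intro idet_cong) (auto simp: conn_diff grid_def sum_distrib_left)
  also have "\<dots> = (\<Prod>i\<in>A. of_int (m i)) *
      (\<Sum>c\<in>Pi\<^sub>E A (\<lambda>j. {x (j - 1)<..x j}).
        (\<Prod>j\<in>A. 1 / of_int (c j)) * idet A (\<lambda>i j. conn N (m i) (c j)))"
    unfolding idet_scale_rows using assms(1) by (subst idet_sum_cols) auto
  finally have "cdet N A m x = \<dots>" .
  moreover have "(\<Prod>i\<in>A. 1 / of_int (m i)) * (\<Prod>i\<in>A. of_int (m i)) = (1 :: real)"
    using assms(3) by (force simp: prod.distrib[symmetric] intro: prod.neutral)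
  ultimately show ?thesis
    unfolding between_tuples_eq[OF assms(2)] by (simp only: mult.assoc[symmetric] mult_1)
qed

text \<open>The sum over \<open>a\<close> is gathered row by row into one determinant,
  \<open>conn_double_sum\<close> is applied to each entry, and the result is expanded along the
  columns.\<close>

lemma cdet_row_transport:
  assumes "finite A" "grid N A x"
    and "\<And>i. i \<in> A \<Longrightarrow> 0 \<le> u i \<and> u i \<le> u (i + 1) \<and> u (i + 1) \<le> int N - 1"
  shows "(\<Sum>a | a \<in> tuples N A \<and> (\<forall>i\<in>A. u i < a i \<and> a i \<le> u (i + 1)).
      (\<Prod>i\<in>A. 1 / of_int (a i)) * cdet N A a x) =
    (\<Sum>b | b \<in> tuples N A \<and> between A x b. (\<Prod>j\<in>A. 1 / of_int (int N - b j)) *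
      idet A (\<lambda>i j. conn N (u i) (b j - 1) - conn N (u (i + 1)) (b j - 1)))"
proof -
  have *: "{a \<in> tuples N A. \<forall>i\<in>A. u i < a i \<and> a i \<le> u (i + 1)} =
      Pi\<^sub>E A (\<lambda>i. {u i<..u (i + 1)})"
    using assms(3) unfolding tuples_def PiE_def Pi_def by force
  have "(\<Sum>a\<in>Pi\<^sub>E A (\<lambda>i. {u i<..u (i + 1)}). (\<Prod>i\<in>A. 1 / of_int (a i)) * cdet N A a x) =
      idet A (\<lambda>i j. \<Sum>a\<in>{u i<..u (i + 1)}. 1 / of_int a * (conn N a (x j) - conn N a (x (j - 1))))"
    unfolding cdet_def using assms(1) by (subst idet_sum_rows) auto
  also have "\<dots> = idet A (\<lambda>i j. \<Sum>b\<in>{x (j - 1)<..x j}. 1 / of_int (int N - b) *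
      (conn N (u i) (b - 1) - conn N (u (i + 1)) (b - 1)))"
    using assms(2,3) by (intro idet_cong conn_double_sum) (auto simp: grid_def)
  also have "\<dots> = (\<Sum>b\<in>Pi\<^sub>E A (\<lambda>j. {x (j - 1)<..x j}). (\<Prod>j\<in>A. 1 / of_int (int N - b j)) *
      idet A (\<lambda>i j. conn N (u i) (b j - 1) - conn N (u (i + 1)) (b j - 1)))"
    using assms(1) by (subst idet_sum_cols) auto
  finally show ?thesis
    unfolding * between_tuples_eq[OF assms(2)] .
qed

text \<open>The index intervals of two consecutive diagonals, where \<open>B\<close> belongs to the lower left one; for an
  empty set the end points are chosen to fit.\<close>

definition adjacent :: "int set \<Rightarrow> int set \<Rightarrow> bool" where
  "adjacent A B \<longleftrightarrow> (\<exists>s t s' t'. A = {s..<t} \<and> B = {s'..<t'} \<and> s \<le> t \<and> s' \<le> t' \<and>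
     s - 1 \<le> s' \<and> s' \<le> s \<and> t - 1 \<le> t' \<and> t' \<le> t)"

text \<open>Bordering for two neighbouring diagonals \<open>A\<close> and \<open>B\<close>: where \<open>m\<close> or \<open>b\<close> is missing at an end, a row
  index 0 (a row of ones), a column value \<open>N - 1\<close> (a column of ones), or values making the
  connector vanish are supplied, so that both interlacing conditions become uniform.\<close>

definition lift_row :: "nat \<Rightarrow> int set \<Rightarrow> int set \<Rightarrow> (int \<Rightarrow> int) \<Rightarrow> int \<Rightarrow> int" where
  "lift_row N A B m i = (if i \<in> A then m i else if i \<in> B then 0 else int N - 1)"

definition lift_col :: "nat \<Rightarrow> int set \<Rightarrow> int set \<Rightarrow> (int \<Rightarrow> int) \<Rightarrow> int \<Rightarrow> int" where
  "lift_col N A B b j = (if j \<in> B then b j - 1 else if j \<in> A then int N - 1 else 0)"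

definition zero_ext :: "int set \<Rightarrow> (int \<Rightarrow> int) \<Rightarrow> int \<Rightarrow> int" where
  "zero_ext A c j = (if j \<in> A then c j else 0)"

text \<open>Both sides are the determinant of the bordered matrix over \<open>A \<union> B\<close>, after row and after
  column differences respectively.\<close>

lemma cdet_bridge:
  assumes "adjacent A B" "m \<in> tuples N A" "b \<in> tuples N B"
  shows "idet B (\<lambda>i j. conn N (lift_row N A B m i) (b j - 1) - conn N (lift_row N A B m (i + 1)) (b j - 1)) =
    cdet N A m (lift_col N A B b)"
proof (cases "A = {} \<and> B = {}")
  case nonempty: False
  from assms(1) obtain s t s' t' where AB: "A = {s..<t}" "B = {s'..<t'}"
    and st: "s \<le> t" "s' \<le> t'" "s - 1 \<le> s'" "s' \<le> s" "t - 1 \<le> t'" "t' \<le> t"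
    unfolding adjacent_def by blast
  have m: "1 \<le> m i" "m i \<le> int N - 1" if "i \<in> A" for i
    using tuplesD[OF assms(2) that] by auto
  have b: "1 \<le> b i" "b i \<le> int N - 1" if "i \<in> B" for i
    using tuplesD[OF assms(3) that] by auto
  define M where "M = (\<lambda>i j. conn N (lift_row N A B m i) (lift_col N A B b j))"
  have row: "idet {s'..<t} M = idet {s'..<t'} (\<lambda>i j. M i j - M (i + 1) j)"
  proof (rule idet_row_differences_border)
    show "s' \<le> t" using st by simp
    show "t = t' \<and> (\<forall>j\<in>{s'..<t}. M t j = 0) \<or> t = t' + 1 \<and> s' < t \<and> (\<forall>i\<in>{s'..<t}. M i (t - 1) = 1)"
    proof (cases "t = t'")
      case True
      \<comment> \<open>Row \<open>t\<close> lies outside both intervals and has index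
        \<open>N - 1\<close>, while every column value is some \<open>b j - 1\<close>, which is
        smaller.\<close>
      have "M t j = 0" if "j \<in> {s'..<t}" for j
        using that True b[of j] unfolding M_def lift_row_def lift_col_def AB
        by (auto intro!: conn_last_left)
      thus ?thesis using True by blast
    next
      case False
      \<comment> \<open>If \<open>A\<close> were empty here, the end point inequalities would force
        \<open>B\<close> to be empty too. The index \<open>t - 1\<close> is then in \<open>A\<close>
        but not in \<open>B\<close> and carries the column value \<open>N - 1\<close>.\<close>
      have "s < t" using False st nonempty AB by auto
      have "M i (t - 1) = 1" if "i \<in> {s'..<t}" for i
      proof -
        have "lift_col N A B b (t - 1) = int N - 1"
          using that False st \<open>s < t\<close> by (auto simp: lift_col_def AB)
        moreover have "0 \<le> lift_row N A B m i \<and> lift_row N A B m i \<le> int N - 1"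
          using that False st \<open>s < t\<close> m[of i] m[of "t - 1"] b[of i] by (auto simp: lift_row_def AB)
        ultimately show ?thesis
          by (simp add: M_def conn_last_right)
      qed
      thus ?thesis using False st by auto
    qed
  qed
  have col: "idet {s'..<t} M = idet {s..<t} (\<lambda>i j. M i j - M i (j - 1))"
  proof (rule idet_col_differences_border)
    show "s' \<le> t" using st by simp
    show "s = s' \<and> (\<forall>i\<in>{s..<t}. M i (s - 1) = 0) \<or> s = s' + 1 \<and> s' < t \<and> (\<forall>j\<in>{s'..<t}. M s' j = 1)"
    proof (cases "s = s'")
      case True
      \<comment> \<open>Column \<open>s - 1\<close> has the value 0, and all rows belong to
        \<open>A\<close>, hence have positive index.\<close>
      have "M i (s - 1) = 0" if "i \<in> {s..<t}" for i
        using that True m[of i] unfolding M_def lift_row_def lift_col_def AB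
        by (auto intro!: conn_zero_right)
      thus ?thesis using True by blast
    next
      case False
      \<comment> \<open>So \<open>s'\<close> is in \<open>B\<close> but not in \<open>A\<close>, and
        its row has index 0.\<close>
      have "s' < t'" using False st nonempty AB by auto
      hence "M s' j = 1" if "j \<in> {s'..<t}" for j
        using that False st unfolding M_def lift_row_def AB by auto
      thus ?thesis using False st by auto
    qed
  qed
  have "idet B (\<lambda>i j. conn N (lift_row N A B m i) (b j - 1) - conn N (lift_row N A B m (i + 1)) (b j - 1))
      = idet {s'..<t'} (\<lambda>i j. M i j - M (i + 1) j)"
    unfolding AB(2)[symmetric] by (intro idet_cong) (auto simp: M_def lift_col_def)
  also have "\<dots> = idet {s..<t} (\<lambda>i j. M i j - M i (j - 1))"
    using row col by simp
  also have "\<dots> = cdet N A m (lift_col N A B b)"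
    unfolding cdet_def AB(1)[symmetric] by (intro idet_cong) (auto simp: M_def lift_row_def)
  finally show ?thesis .
qed (simp add: cdet_def)

text \<open>The value 0 left of \<open>A\<close> gives a vanishing column, so column differences can
  be undone without a border.\<close>

lemma cdet_zero_ext:
  assumes "A = {s..<t}" "\<And>i. i \<in> A \<Longrightarrow> 1 \<le> m i"
  shows "cdet N A m (zero_ext A c) = idet A (\<lambda>i j. conn N (m i) (c j))"
proof (cases "s \<le> t")
  case True
  have "idet A (\<lambda>i j. conn N (m i) (c j)) = idet {s..<t} (\<lambda>i j. conn N (m i) (zero_ext A c j))"
    unfolding assms(1)[symmetric] by (intro idet_cong) (auto simp: zero_ext_def)
  also have "\<dots> = idet {s..<t} (\<lambda>i j. conn N (m i) (zero_ext A c j) - conn N (m i) (zero_ext A c (j - 1)))"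
    using True assms by (intro idet_col_differences_border) (auto simp: zero_ext_def conn_zero_right)
  finally show ?thesis
    unfolding cdet_def assms(1) by simp
qed (simp add: assms cdet_def)

section \<open>Passing from one diagonal to the next\<close>

text \<open>The invariant: as a function of the current diagonal, the part \<open>V\<close> already summed on the \<open>\<zeta>\<close> side is
  a combination of connector determinants, and \<open>E\<close>, the corresponding part on the \<open>\<zeta>\<^sup>\<flat>\<close> side, is the
  combination with the same coefficients of the interlacing indicators. The difference formulas need
  monotone grids, which restricts \<open>V\<close> to strictly increasing tuples.\<close>

definition interlaced_rep ::
    "nat \<Rightarrow> int set \<Rightarrow> ((int \<Rightarrow> int) \<Rightarrow> real) \<Rightarrow> ((int \<Rightarrow> int) \<Rightarrow> real) \<Rightarrow> bool" where
  "interlaced_rep N A V E \<longleftrightarrow> (\<exists>(Z :: (int \<Rightarrow> int) set) u x. finite Z \<and> (\<forall>z\<in>Z. grid N A (x z)) \<and>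
     (\<forall>m\<in>tuples N A. strict_mono_on A m \<longrightarrow> V m = (\<Sum>z\<in>Z. u z * cdet N A m (x z))) \<and>
     (\<forall>c\<in>tuples N A. E c = (\<Sum>z\<in>Z. if between A (x z) c then u z else 0)))"

lemma interlaced_repI:
  fixes Z :: "(int \<Rightarrow> int) set"
  assumes "finite Z" "\<And>z. z \<in> Z \<Longrightarrow> grid N A (x z)"
    "\<And>m. m \<in> tuples N A \<Longrightarrow> strict_mono_on A m \<Longrightarrow> V m = (\<Sum>z\<in>Z. u z * cdet N A m (x z))"
    "\<And>c. c \<in> tuples N A \<Longrightarrow> E c = (\<Sum>z\<in>Z. if between A (x z) c then u z else 0)"
  shows "interlaced_rep N A V E"
  unfolding interlaced_rep_def
  by (intro exI[of _ Z] exI[of _ u] exI[of _ x] conjI ballI impI assms)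

lemma grid_mono:
  assumes "grid N {s..<t} x" "s \<le> i" "i \<le> j" "j < t"
  shows "x i \<le> x j"
  using assms(3,4)
proof (induction j rule: int_ge_induct)
  case (step j)
  have "x ((j + 1) - 1) \<le> x (j + 1)"
    using assms(1)[unfolded grid_def, rule_format, of "j + 1"] assms(2) step by auto
  thus ?case using step by simp
qed simp

text \<open>A grid cuts out disjoint half-open intervals in increasing order, and \<open>c\<close>
  takes one point from each.\<close>

lemma between_strict_mono_on:
  assumes "A = {s..<t}" "grid N A x" "between A x c"
  shows "strict_mono_on A c"
proof (rule strict_mono_onI)
  fix i j assume ij: "i \<in> A" "j \<in> A" "i < j"
  have "c i \<le> x i" "x (j - 1) < c j"
    using assms(3) ij by (auto simp: between_def)
  moreover have "x i \<le> x (j - 1)"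
    using grid_mono[of N s t x i "j - 1"] ij assms(1,2) by auto
  ultimately show "c i < c j" by simp
qed

text \<open>Thus \<open>E\<close> vanishes on tuples that are not strictly increasing, which allows
  sums over all tuples to be cut down to those that yield grids.\<close>

lemma interlaced_rep_support:
  assumes "A = {s..<t}" "\<forall>z\<in>Z. grid N A (x z)" "\<not> strict_mono_on A c"
  shows "(\<Sum>z\<in>Z. if between A (x z) c then u z else 0) = (0 :: real)"
proof (intro sum.neutral ballI)
  fix z assume "z \<in> Z"
  hence "\<not> between A (x z) c"
    using between_strict_mono_on[OF assms(1)] assms(2,3) by blast
  thus "(if between A (x z) c then u z else 0) = 0" by simp
qed

text \<open>Where the left neighbour is missing, the lower bound 0 holds automatically since entries
  are positive.\<close>

lemma between_zero_ext_iff: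
  assumes "c \<in> tuples N A"
  shows "between A (zero_ext A b) c \<longleftrightarrow> tri_le A c A b"
proof -
  have "0 < c j" if "j \<in> A" for j
    using tuplesD[OF assms that] by simp
  thus ?thesis
    unfolding between_def zero_ext_def tri_le_def by auto
qed

lemma grid_zero_ext:
  assumes "c \<in> tuples N A" "strict_mono_on A c"
  shows "grid N A (zero_ext A c)"
  unfolding grid_def
proof
  fix j assume j: "j \<in> A"
  show "0 \<le> zero_ext A c (j - 1) \<and> zero_ext A c (j - 1) \<le> zero_ext A c j \<and> zero_ext A c j \<le> int N - 1"
    using j tuplesD[OF assms(1), of j] tuplesD[OF assms(1), of "j - 1"]
      strict_mono_onD[OF assms(2), of "j - 1" j]
    unfolding zero_ext_def by auto
qed

text \<open>One step inside a diagonal: column transport trades one factor \<open>1 / m\<close> per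
  cell for one more tuple \<open>b\<close> of the flat sum.\<close>

lemma interlaced_rep_within:
  assumes A: "A = {s..<t}" and rep: "interlaced_rep N A V E"
  shows "interlaced_rep N A (\<lambda>m. (\<Prod>j\<in>A. 1 / of_int (m j)) * V m)
    (\<lambda>c. \<Sum>b | b \<in> tuples N A \<and> tri_le A c A b. (\<Prod>j\<in>A. 1 / of_int (b j)) * E b)"
proof -
  from rep obtain Z :: "(int \<Rightarrow> int) set" and u x where Z: "finite Z" "\<forall>z\<in>Z. grid N A (x z)"
    and V: "\<And>m. m \<in> tuples N A \<Longrightarrow> strict_mono_on A m \<Longrightarrow> V m = (\<Sum>z\<in>Z. u z * cdet N A m (x z))"
    and E: "\<And>c. c \<in> tuples N A \<Longrightarrow> E c = (\<Sum>z\<in>Z. if between A (x z) c then u z else 0)"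
    unfolding interlaced_rep_def by blast
  have fin: "finite A" using A by simp
  let ?w = "\<lambda>b. (\<Prod>j\<in>A. 1 / of_int (b j)) :: real"
  let ?T = "{b \<in> tuples N A. strict_mono_on A b}"
  have E0: "E b = 0" if "b \<in> tuples N A" "\<not> strict_mono_on A b" for b
    using interlaced_rep_support[OF A Z(2) that(2)] E[OF that(1)] by simp
  show ?thesis
  \<comment> \<open>The summed tuples \<open>b\<close> become the new index set; the old
    coefficients have been collected into \<open>E b\<close>.\<close>
  proof (rule interlaced_repI[of ?T _ _ "zero_ext A" _ "\<lambda>b. ?w b * E b"])
    show "finite ?T" using fin by simp
    show "grid N A (zero_ext A b)" if "b \<in> ?T" for b
      using that grid_zero_ext by auto
  next
    fix m assume m: "m \<in> tuples N A" "strict_mono_on A m"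
    have m1: "1 \<le> m i" if "i \<in> A" for i
      using tuplesD[OF m(1) that] by simp
    have ext: "cdet N A m (zero_ext A b) = idet A (\<lambda>i j. conn N (m i) (b j))" for b
      using m1 by (rule cdet_zero_ext[OF A])
    have "?w m * V m = (\<Sum>z\<in>Z. u z * (?w m * cdet N A m (x z)))"
      unfolding V[OF m] by (simp add: sum_distrib_left mult_ac)
    also have "\<dots> = (\<Sum>z\<in>Z. u z * (\<Sum>b | b \<in> tuples N A \<and> between A (x z) b.
        ?w b * idet A (\<lambda>i j. conn N (m i) (b j))))"
      using Z m1 fin by (intro sum.cong refl arg_cong2[where f = "(*)"] cdet_col_transport) auto
    also have "\<dots> = (\<Sum>z\<in>Z. \<Sum>b\<in>tuples N A. (if between A (x z) b then u z else 0) *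
        (?w b * cdet N A m (zero_ext A b)))"
      unfolding ext using fin
      by (intro sum.cong refl) (auto simp: sum_distrib_left sum.inter_filter intro!: sum.cong)
    also have "\<dots> = (\<Sum>b\<in>tuples N A. ?w b * E b * cdet N A m (zero_ext A b))"
      by (subst sum.swap, intro sum.cong refl) (simp add: E sum_distrib_right sum_distrib_left mult_ac)
    also have "\<dots> = (\<Sum>b\<in>?T. ?w b * E b * cdet N A m (zero_ext A b))"
      using fin E0 by (intro sum.mono_neutral_right) auto
    finally show "?w m * V m = \<dots>" .
  next
    fix c assume c: "c \<in> tuples N A"
    have "(\<Sum>b | b \<in> tuples N A \<and> tri_le A c A b. ?w b * E b) =
        (\<Sum>b\<in>tuples N A. if tri_le A c A b then ?w b * E b else 0)"
      using fin by (intro sum.inter_filter finite_tuples)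
    also have "\<dots> = (\<Sum>b\<in>?T. if tri_le A c A b then ?w b * E b else 0)"
      using fin E0 by (intro sum.mono_neutral_right) auto
    finally show "(\<Sum>b | b \<in> tuples N A \<and> tri_le A c A b. ?w b * E b) =
        (\<Sum>b\<in>?T. if between A (zero_ext A b) c then ?w b * E b else 0)"
      by (simp add: between_zero_ext_iff[OF c])
  qed
qed

section \<open>Crossing to a neighbouring diagonal\<close>

lemma adjacentE:
  assumes "adjacent A B"
  obtains s t s' t' where "A = {s..<t}" "B = {s'..<t'}" "s \<le> t" "s' \<le> t'" "s - 1 \<le> s'" "s' \<le> s"
    "t - 1 \<le> t'" "t' \<le> t"
  using assms unfolding adjacent_def by (elim exE conjE) (rule that; assumption)

text \<open>Subtracting 1 from \<open>b\<close> swaps strict and weak inequalities; the supplied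
  values \<open>N - 1\<close> and 0 impose no condition on entries from 1 to
  \<open>N - 1\<close>.\<close>

lemma between_lift_col_iff:
  assumes "adjacent A B" "c \<in> tuples N A"
  shows "between A (lift_col N A B b) c \<longleftrightarrow> tri_lt A c B b"
proof -
  have adj: "j - 1 \<in> A \<Longrightarrow> j \<in> A \<Longrightarrow> j - 1 \<in> B" for j
    using assms(1) by (elim adjacentE) auto
  show ?thesis
    using tuplesD[OF assms(2)] adj unfolding between_def lift_col_def tri_lt_def by fastforce
qed

lemma grid_lift_col:
  assumes "adjacent A B" "0 < N" "b \<in> tuples N B" "strict_mono_on B b"
  shows "grid N A (lift_col N A B b)"
proof -
  have "j - 1 \<in> A \<Longrightarrow> j \<in> A \<Longrightarrow> j - 1 \<in> B" for j
    using assms(1) by (elim adjacentE) auto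
  thus ?thesis
    using tuplesD[OF assms(3)] strict_mono_onD[OF assms(4)] assms(2)
    unfolding grid_def lift_col_def by (fastforce simp: less_imp_le)
qed

lemma lift_row_iff:
  assumes "adjacent A B" "a \<in> tuples N B"
  shows "(\<forall>i\<in>B. lift_row N A B m i < a i \<and> a i \<le> lift_row N A B m (i + 1)) \<longleftrightarrow> tri_lt A m B a"
proof -
  have adj: "j \<in> B \<Longrightarrow> j + 1 \<in> B \<Longrightarrow> j + 1 \<in> A" for j
    using assms(1) by (elim adjacentE) auto
  have "tri_lt A m B a \<longleftrightarrow> (\<forall>i\<in>B. (i \<in> A \<longrightarrow> m i < a i) \<and> (i + 1 \<in> A \<longrightarrow> a i \<le> m (i + 1)))"
    unfolding tri_lt_def by (metis IntE IntI add_diff_cancel_right' diff_add_cancel)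
  also have "\<dots> \<longleftrightarrow> (\<forall>i\<in>B. lift_row N A B m i < a i \<and> a i \<le> lift_row N A B m (i + 1))"
    using tuplesD[OF assms(2)] adj unfolding lift_row_def by fastforce
  finally show ?thesis ..
qed

text \<open>For \<open>i < j\<close> one has \<open>a i \<le> m (i + 1) \<le> m j < a j\<close>.
  Hence only tuples on which the representation controls \<open>V\<close> enter the sum.\<close>

lemma tri_lt_strict_mono_on:
  assumes "adjacent A B" "tri_lt A m B a" "strict_mono_on A m"
  shows "strict_mono_on B a"
proof (rule strict_mono_onI)
  fix i j assume ij: "i \<in> B" "j \<in> B" "i < j"
  have "i + 1 \<in> A" "j \<in> A"
    using assms(1) ij by (auto elim!: adjacentE)
  hence "a i \<le> m (i + 1)" "m j < a j" "m (i + 1) \<le> m j"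
    using ij assms(2) strict_mono_onD[OF assms(3), of "i + 1" j]
    unfolding tri_lt_def by (force, force, cases "i + 1 = j", auto)
  thus "a i < a j" by simp
qed

text \<open>Row transport on \<open>B\<close> turns the weight \<open>1 / a\<close> on the side of
  \<open>V\<close> into \<open>1 / (N - b)\<close> on the side of \<open>E\<close>; the bridge then
  replaces the determinant over \<open>B\<close> by one over \<open>A\<close>.\<close>

lemma interlaced_rep_step:
  assumes adj: "adjacent A B" and N: "0 < N" and rep: "interlaced_rep N B V E"
  shows "interlaced_rep N A
    (\<lambda>m. \<Sum>a | a \<in> tuples N B \<and> tri_lt A m B a. (\<Prod>j\<in>B. 1 / of_int (a j)) * V a)
    (\<lambda>c. \<Sum>b | b \<in> tuples N B \<and> tri_lt A c B b. (\<Prod>j\<in>B. 1 / of_int (int N - b j)) * E b)"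
proof -
  from rep obtain Z :: "(int \<Rightarrow> int) set" and u x where Z: "finite Z" "\<forall>z\<in>Z. grid N B (x z)"
    and V: "\<And>m. m \<in> tuples N B \<Longrightarrow> strict_mono_on B m \<Longrightarrow> V m = (\<Sum>z\<in>Z. u z * cdet N B m (x z))"
    and E: "\<And>c. c \<in> tuples N B \<Longrightarrow> E c = (\<Sum>z\<in>Z. if between B (x z) c then u z else 0)"
    unfolding interlaced_rep_def by blast
  from adj obtain s' t' where B: "B = {s'..<t'}" by (auto elim!: adjacentE)
  hence fin: "finite B" by simp
  let ?v = "\<lambda>a. (\<Prod>j\<in>B. 1 / of_int (a j)) :: real"
  let ?w = "\<lambda>b. (\<Prod>j\<in>B. 1 / of_int (int N - b j)) :: real"
  let ?T = "{b \<in> tuples N B. strict_mono_on B b}"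
  have E0: "E b = 0" if "b \<in> tuples N B" "\<not> strict_mono_on B b" for b
    using interlaced_rep_support[OF B Z(2) that(2)] E[OF that(1)] by simp
  show ?thesis
  proof (rule interlaced_repI[of ?T _ _ "lift_col N A B" _ "\<lambda>b. ?w b * E b"])
    show "finite ?T" using fin by simp
    show "grid N A (lift_col N A B b)" if "b \<in> ?T" for b
      using that grid_lift_col[OF adj N] by auto
  next
    fix m assume m: "m \<in> tuples N A" "strict_mono_on A m"
    let ?u = "lift_row N A B m"
    have u: "0 \<le> ?u i \<and> ?u i \<le> ?u (i + 1) \<and> ?u (i + 1) \<le> int N - 1" if "i \<in> B" for i
    proof -
      have "i \<in> B \<Longrightarrow> i + 1 \<in> B \<Longrightarrow> i + 1 \<in> A"
        using adj by (elim adjacentE) auto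
      thus ?thesis
        using that tuplesD[OF m(1), of i] tuplesD[OF m(1), of "i + 1"]
          strict_mono_onD[OF m(2), of i "i + 1"] N
        unfolding lift_row_def by auto
    qed
    have eq: "{a. a \<in> tuples N B \<and> tri_lt A m B a} =
        {a. a \<in> tuples N B \<and> (\<forall>i\<in>B. ?u i < a i \<and> a i \<le> ?u (i + 1))}"
      using lift_row_iff[OF adj] by auto
    have "(\<Sum>a | a \<in> tuples N B \<and> tri_lt A m B a. ?v a * V a) =
        (\<Sum>a | a \<in> tuples N B \<and> tri_lt A m B a. \<Sum>z\<in>Z. u z * (?v a * cdet N B a (x z)))"
      using tri_lt_strict_mono_on[OF adj _ m(2)]
      by (intro sum.cong refl) (simp add: V sum_distrib_left mult_ac)
    also have "\<dots> = (\<Sum>z\<in>Z. u z * (\<Sum>a | a \<in> tuples N B \<and> tri_lt A m B a. ?v a * cdet N B a (x z)))"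
      by (subst sum.swap) (simp add: sum_distrib_left)
    also have "\<dots> = (\<Sum>z\<in>Z. u z * (\<Sum>b | b \<in> tuples N B \<and> between B (x z) b. ?w b *
        idet B (\<lambda>i j. conn N (?u i) (b j - 1) - conn N (?u (i + 1)) (b j - 1))))"
      unfolding eq using Z u fin
      by (intro sum.cong refl arg_cong2[where f = "(*)"] cdet_row_transport) auto
    \<comment> \<open>Here the bridge moves the determinant to \<open>A\<close>, with a grid that
      depends only on \<open>b\<close>.\<close>
    also have "\<dots> = (\<Sum>z\<in>Z. \<Sum>b\<in>tuples N B. (if between B (x z) b then u z else 0) *
        (?w b * cdet N A m (lift_col N A B b)))"
      using fin cdet_bridge[OF adj m(1)]
      by (intro sum.cong refl) (auto simp: sum_distrib_left sum.inter_filter intro!: sum.cong)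
    also have "\<dots> = (\<Sum>b\<in>tuples N B. ?w b * E b * cdet N A m (lift_col N A B b))"
      by (subst sum.swap, intro sum.cong refl) (simp add: E sum_distrib_right sum_distrib_left mult_ac)
    also have "\<dots> = (\<Sum>b\<in>?T. ?w b * E b * cdet N A m (lift_col N A B b))"
      using fin E0 by (intro sum.mono_neutral_right) auto
    finally show "(\<Sum>a | a \<in> tuples N B \<and> tri_lt A m B a. ?v a * V a) = \<dots>" .
  next
    fix c assume c: "c \<in> tuples N A"
    have "(\<Sum>b | b \<in> tuples N B \<and> tri_lt A c B b. ?w b * E b) =
        (\<Sum>b\<in>tuples N B. if tri_lt A c B b then ?w b * E b else 0)"
      using fin by (intro sum.inter_filter finite_tuples)
    also have "\<dots> = (\<Sum>b\<in>?T. if tri_lt A c B b then ?w b * E b else 0)"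
      using fin E0 by (intro sum.mono_neutral_right) auto
    finally show "(\<Sum>b | b \<in> tuples N B \<and> tri_lt A c B b. ?w b * E b) =
        (\<Sum>b\<in>?T. if between A (lift_col N A B b) c then ?w b * E b else 0)"
      by (simp add: between_lift_col_iff[OF adj c])
  qed
qed

section \<open>The two ends of the diagram\<close>

lemma tuples_empty [simp]: "tuples N {} = {\<lambda>_. undefined}"
  by (simp add: tuples_def)

text \<open>An empty neighbour leaves at most one element in \<open>A\<close>. The grid running from
  0 to \<open>N - 1\<close> there has determinant 1 and interlaces with every tuple.\<close>

lemma interlaced_rep_base:
  assumes adj: "adjacent A {}" and N: "0 < N"
  shows "interlaced_rep N A (\<lambda>_. 1) (\<lambda>_. 1)"
proof -
  let ?z = "\<lambda>_::int. undefined :: int"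
  from adj obtain s t where st: "A = {s..<t}" "s \<le> t" "t \<le> s + 1"
    by (elim adjacentE) auto
  show ?thesis
  proof (rule interlaced_repI[of "{?z}" _ _ "lift_col N A {}" _ "\<lambda>_. 1"])
    show "grid N A (lift_col N A {} z)" if "z \<in> {?z}" for z
      using grid_lift_col[OF adj N] that by (auto intro!: strict_mono_onI)
    fix c assume c: "c \<in> tuples N A"
    show "1 = (\<Sum>z\<in>{?z}. if between A (lift_col N A {} z) c then 1 else (0::real))"
      using between_lift_col_iff[OF adj c] by (simp add: tri_lt_def)
  next
    fix m assume m: "m \<in> tuples N A"
    show "1 = (\<Sum>z\<in>{?z}. 1 * cdet N A m (lift_col N A {} z))"
    proof (cases "A = {}")
      case False
      hence "t = s + 1" using st by auto
      hence A: "A = {s}" using st by auto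
      thus ?thesis using tuplesD[OF m, of s]
        by (simp add: cdet_def lift_col_def conn_last_right conn_zero_right)
    qed (simp add: cdet_def)
  qed simp
qed

text \<open>Empty determinants are 1 and empty interlacing conditions hold, so both values are the
  sum of the coefficients.\<close>

lemma interlaced_rep_empty:
  assumes "interlaced_rep N {} V E"
  shows "V (\<lambda>_. undefined) = E (\<lambda>_. undefined)"
proof -
  obtain Z :: "(int \<Rightarrow> int) set" and u x where
    "V (\<lambda>_. undefined) = (\<Sum>z\<in>Z. u z * cdet N {} (\<lambda>_. undefined) (x z))"
    "E (\<lambda>_. undefined) = (\<Sum>z\<in>Z. if between {} (x z) (\<lambda>_. undefined) then u z else 0)"
    using assms unfolding interlaced_rep_def tuples_empty by (auto simp: strict_mono_on_def)
  thus ?thesis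
    by (simp add: cdet_def between_def)
qed

section \<open>Sums over chains\<close>

text \<open>The sum over chains in nested form, with \<open>x\<close> fixed at the preceding
  position \<open>i\<close>: a tail sum is a function of the preceding tuple, as the invariant
  requires.\<close>

fun chain_sum :: "('i \<Rightarrow> 'b set) \<Rightarrow> ('i \<Rightarrow> 'i \<Rightarrow> 'b \<Rightarrow> 'b \<Rightarrow> bool) \<Rightarrow> ('i \<Rightarrow> 'b \<Rightarrow> real) \<Rightarrow>
    'i \<Rightarrow> 'b \<Rightarrow> 'i list \<Rightarrow> real" where
  "chain_sum X R w i x [] = 1"
| "chain_sum X R w i x (j # js) = (\<Sum>y | y \<in> X j \<and> R i j x y. w j y * chain_sum X R w j y js)"

lemma chain_sum_eq:
  assumes "distinct (i # js)" "\<And>j. j \<in> set js \<Longrightarrow> finite (X j)"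
  shows "chain_sum X R w i x js =
    (\<Sum>n | n \<in> Pi\<^sub>E (set js) X \<and> successively (\<lambda>a b. R a b ((n(i := x)) a) ((n(i := x)) b)) (i # js).
      \<Prod>j\<in>set js. w j (n j))"
  using assms
proof (induction js arbitrary: i x)
  case Nil
  have "{n :: 'a \<Rightarrow> 'b. n \<in> Pi\<^sub>E {} X} = {\<lambda>_. undefined}" by auto
  thus ?case by simp
next
  case (Cons j js)
  let ?S = "set js"
  let ?Q = "\<lambda>i x n js. successively (\<lambda>a b. R a b ((n(i := x)) a) ((n(i := x)) b)) (i # js)"
  have j: "j \<notin> ?S" "i \<noteq> j" "i \<notin> ?S" using Cons.prems by auto
  have fin: "finite (X j)" "finite (Pi\<^sub>E ?S X)"
    using Cons.prems by (auto intro: finite_PiE)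
  have Q: "?Q i x (g(j := y)) (j # js) \<longleftrightarrow> R i j x y \<and> ?Q j y g js" for g y
  proof -
    have "successively (\<lambda>a b. R a b (((g(j := y))(i := x)) a) (((g(j := y))(i := x)) b)) (j # js) \<longleftrightarrow>
        successively (\<lambda>a b. R a b ((g(j := y)) a) ((g(j := y)) b)) (j # js)"
      using j by (intro successively_cong) auto
    thus ?thesis using j by simp
  qed
  have prod: "(\<Prod>k\<in>set (j # js). w k ((g(j := y)) k)) = w j y * (\<Prod>k\<in>?S. w k (g k))" for g y
  proof -
    have "(\<Prod>k\<in>?S. w k ((g(j := y)) k)) = (\<Prod>k\<in>?S. w k (g k))"
      using j by (intro prod.cong) auto
    thus ?thesis using j by simp
  qed
  have finE: "finite (Pi\<^sub>E (set (j # js)) X)"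
    using Cons.prems by (intro finite_PiE) auto
  have "(\<Sum>n | n \<in> Pi\<^sub>E (set (j # js)) X \<and> ?Q i x n (j # js). \<Prod>k\<in>set (j # js). w k (n k)) =
      (\<Sum>n\<in>Pi\<^sub>E (set (j # js)) X. if ?Q i x n (j # js) then \<Prod>k\<in>set (j # js). w k (n k) else 0)"
    using finE by (rule sum.inter_filter)
  also have "\<dots> = (\<Sum>n\<in>(\<lambda>(y, g). g(j := y)) ` (X j \<times> Pi\<^sub>E ?S X).
      if ?Q i x n (j # js) then \<Prod>k\<in>set (j # js). w k (n k) else 0)"
    unfolding list.set PiE_insert_eq ..
  also have "\<dots> = (\<Sum>(y, g)\<in>X j \<times> Pi\<^sub>E ?S X.
      if ?Q i x (g(j := y)) (j # js) then \<Prod>k\<in>set (j # js). w k ((g(j := y)) k) else 0)"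
    by (subst sum.reindex[OF inj_combinator[OF j(1)]]) (simp add: o_def case_prod_unfold)
  also have "\<dots> = (\<Sum>(y, g)\<in>X j \<times> Pi\<^sub>E ?S X.
      if R i j x y \<and> ?Q j y g js then w j y * (\<Prod>k\<in>?S. w k (g k)) else 0)"
    unfolding Q prod ..
  also have "\<dots> = (\<Sum>y\<in>X j. \<Sum>g\<in>Pi\<^sub>E ?S X.
      if R i j x y \<and> ?Q j y g js then w j y * (\<Prod>k\<in>?S. w k (g k)) else 0)"
    by (rule sum.cartesian_product[symmetric])
  also have "\<dots> = (\<Sum>y\<in>X j. if R i j x y then w j y * chain_sum X R w j y js else 0)"
  proof (intro sum.cong refl)
    fix y
    have "chain_sum X R w j y js = (\<Sum>g\<in>Pi\<^sub>E ?S X. if ?Q j y g js then \<Prod>k\<in>?S. w k (g k) else 0)"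
      using Cons.prems fin by (subst Cons.IH) (auto intro!: sum.inter_filter simp del: successively.simps)
    thus "(\<Sum>g\<in>Pi\<^sub>E ?S X. if R i j x y \<and> ?Q j y g js then w j y * (\<Prod>k\<in>?S. w k (g k)) else 0) =
        (if R i j x y then w j y * chain_sum X R w j y js else 0)"
      by (auto simp: sum_distrib_left simp del: successively.simps intro!: sum.cong)
  qed
  also have "\<dots> = chain_sum X R w i x (j # js)"
    using fin by (simp add: sum.inter_filter)
  finally show ?case ..
qed

text \<open>Lexicographic order, in which the conditions on flat families link only consecutive
  positions.\<close>

definition levels :: "(int \<Rightarrow> nat) \<Rightarrow> int \<Rightarrow> int \<Rightarrow> (int \<times> nat) list" where
  "levels K a b = concat (map (\<lambda>p. map (Pair p) [1..<Suc (K p)]) [a..b])"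

lemma levels_empty [simp]: "b < a \<Longrightarrow> levels K a b = []"
  by (simp add: levels_def)

lemma levels_rec: "a \<le> b \<Longrightarrow> levels K a b = map (Pair a) [1..<Suc (K a)] @ levels K (a + 1) b"
  by (simp add: levels_def upto_rec1)

lemma set_levels: "set (levels K a b) = (SIGMA p:{a..b}. {1..K p})"
  by (force simp: levels_def simp del: upt_Suc)

lemma distinct_levels: "distinct (levels K a b)"
proof (induction "nat (b - a + 1)" arbitrary: a)
  case (Suc n)
  hence "a \<le> b" "distinct (levels K (a + 1) b)" by auto
  thus ?case
    by (auto simp: levels_rec distinct_map set_levels inj_on_def simp del: upt_Suc)
qed simp

lemma hd_levels: "a \<le> b \<Longrightarrow> 1 \<le> K a \<Longrightarrow> levels K a b \<noteq> [] \<and> hd (levels K a b) = (a, 1)"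
  by (simp add: levels_rec upt_rec)

text \<open>Neighbours lie in one block or join the end of block \<open>p\<close> to the start of
  block \<open>p + 1\<close>; positivity of \<open>K\<close> rules out empty blocks.\<close>

lemma successively_levels:
  assumes "\<And>p. 1 \<le> K p"
  shows "successively Q (levels K a b) \<longleftrightarrow>
    (\<forall>p\<in>{a..b}. \<forall>l\<in>{1..<K p}. Q (p, l) (p, l + 1)) \<and> (\<forall>p\<in>{a..<b}. Q (p, K p) (p + 1, 1))"
proof (induction "nat (b - a + 1)" arbitrary: a)
  case (Suc n)
  hence ab: "a \<le> b" and n: "n = nat (b - (a + 1) + 1)" by auto
  have block: "successively Q (map (Pair a) [1..<Suc (K a)]) \<longleftrightarrow> (\<forall>l\<in>{1..<K a}. Q (a, l) (a, l + 1))"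
  proof -
    have "successively Q (map (Pair a) [1..<Suc (K a)]) \<longleftrightarrow>
        (\<forall>i. Suc i < K a \<longrightarrow> Q (a, Suc i) (a, Suc (Suc i)))"
      by (simp add: successively_conv_nth del: upt_Suc)
    also have "\<dots> \<longleftrightarrow> (\<forall>l\<in>{1..<K a}. Q (a, l) (a, l + 1))"
      by (auto simp: Suc_le_eq) (metis Suc_pred)
    finally show ?thesis .
  qed
  have split: "{a..b} = insert a {a + 1..b}"
    using ab by auto
  have last: "last (map (Pair a) [1..<Suc (K a)]) = (a, K a)" "map (Pair a) [1..<Suc (K a)] \<noteq> []"
    using assms[of a] by (auto simp: last_map)
  show ?case
  proof (cases "a < b")
    case True
    hence split': "{a..<b} = insert a {a + 1..<b}" by auto
    have "levels K (a + 1) b \<noteq> []" "hd (levels K (a + 1) b) = (a + 1, 1)"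
      using True hd_levels[of "a + 1" b K] assms by auto
    thus ?thesis
      unfolding levels_rec[OF ab] successively_append_iff block Suc.hyps(1)[OF n] split split' last
      using last(2) by (simp del: upt_Suc) blast
  next
    case False
    hence "b = a" using ab by simp
    thus ?thesis
      unfolding levels_rec[OF ab] using block by (simp del: upt_Suc)
  qed
qed auto

lemma successively_upto: "successively Q [a..b] \<longleftrightarrow> (\<forall>p\<in>{a..<b}. Q p (p + 1))"
proof -
  have "successively Q [a..b] \<longleftrightarrow> (\<forall>i. Suc i < nat (b - a + 1) \<longrightarrow> Q (a + int i) (a + int i + 1))"
    by (simp add: successively_conv_nth nth_upto algebra_simps)
  also have "\<dots> \<longleftrightarrow> (\<forall>p\<in>{a..<b}. Q p (p + 1))"
  proof (intro iffI ballI allI impI)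
    fix p assume *: "\<forall>i. Suc i < nat (b - a + 1) \<longrightarrow> Q (a + int i) (a + int i + 1)" "p \<in> {a..<b}"
    thus "Q p (p + 1)"
      using *(1)[rule_format, of "nat (p - a)"] by auto
  qed auto
  finally show ?thesis .
qed

text \<open>Induction from the empty diagonal \<open>b + 1\<close> down to the empty diagonal
  \<open>a - 1\<close>, where the invariant becomes an equality of numbers.\<close>

lemma chain_sum_duality:
  fixes A :: "int \<Rightarrow> int set" and K :: "int \<Rightarrow> nat" and N :: nat
  defines "X \<equiv> \<lambda>p. tuples N (A p)"
  defines "R \<equiv> \<lambda>p q m n. tri_lt (A p) m (A q) n"
  defines "w \<equiv> \<lambda>p m. (\<Prod>j\<in>A p. 1 / of_int (m j)) ^ K p"
  defines "X' \<equiv> \<lambda>(p, l::nat). tuples N (A p)"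
  defines "R' \<equiv> \<lambda>(p, l) (q, l') m n. if p = q then tri_le (A p) m (A p) n else tri_lt (A p) m (A q) n"
  defines "w' \<equiv> \<lambda>(p, l) n. if l = (1::nat) then \<Prod>j\<in>A p. 1 / of_int (int N - n j) else \<Prod>j\<in>A p. 1 / of_int (n j)"
  assumes N: "0 < N" and K: "\<And>p. 1 \<le> K p" and adj: "\<And>p. adjacent (A p) (A (p + 1))"
    and empty: "A (a - 1) = {}" "A (b + 1) = {}" and ab: "a - 1 \<le> b" and Ka: "K (a - 1) = 1"
  shows "chain_sum X R w (a - 1) (\<lambda>_. undefined) [a..b] =
    chain_sum X' R' w' (a - 1, 1) (\<lambda>_. undefined) (levels K a b)"
proof -
  \<comment> \<open>With the tuple at level \<open>l\<close> of diagonal \<open>p\<close> fixed,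
    \<open>V\<close> contains \<open>K p - l\<close> of its factors and all later diagonals, and
    \<open>E\<close> sums over the positions after \<open>(p, l)\<close>.\<close>
  define V where "V = (\<lambda>p l m. (\<Prod>j\<in>A p. 1 / of_int (m j)) ^ (K p - l) * chain_sum X R w p m [p + 1..b])"
  define E where "E = (\<lambda>p l c. chain_sum X' R' w' (p, l) c (map (Pair p) [Suc l..<Suc (K p)] @ levels K (p + 1) b))"
  have E_last: "E p (K p) = (\<lambda>c. chain_sum X' R' w' (p, K p) c (levels K (p + 1) b))" for p
    by (simp add: E_def)
  have within: "interlaced_rep N (A p) (V p l) (E p l)"
    if "interlaced_rep N (A p) (V p (K p)) (E p (K p))" "1 \<le> l" "l \<le> K p" for p l
    using that(3,2)
  proof (induction l rule: inc_induct)
    case base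
    show ?case by (rule that)
  next
    case (step l)
    obtain s t where st: "A p = {s..<t}" using adj[of p] by (elim adjacentE)
    have V: "V p l = (\<lambda>m. (\<Prod>j\<in>A p. 1 / of_int (m j)) * V p (Suc l) m)"
    proof
      fix m
      have "K p - l = Suc (K p - Suc l)" using step by simp
      thus "V p l m = (\<Prod>j\<in>A p. 1 / of_int (m j)) * V p (Suc l) m"
        unfolding V_def by (simp add: mult.assoc)
    qed
    have E: "E p l = (\<lambda>c. \<Sum>b | b \<in> tuples N (A p) \<and> tri_le (A p) c (A p) b.
        (\<Prod>j\<in>A p. 1 / of_int (b j)) * E p (Suc l) b)"
    proof
      fix c
      have upt: "[Suc l..<Suc (K p)] = Suc l # [Suc (Suc l)..<Suc (K p)]"
        using step by (intro upt_conv_Cons) simp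
      have "R' (p, l) (p, Suc l) = (\<lambda>m n. tri_le (A p) m (A p) n)" "X' (p, Suc l) = tuples N (A p)"
        "w' (p, Suc l) = (\<lambda>n. \<Prod>j\<in>A p. 1 / of_int (n j))"
        using step by (auto simp: R'_def X'_def w'_def)
      thus "E p l c = (\<Sum>b | b \<in> tuples N (A p) \<and> tri_le (A p) c (A p) b.
          (\<Prod>j\<in>A p. 1 / of_int (b j)) * E p (Suc l) b)"
        unfolding E_def upt by simp
    qed
    show ?case unfolding V E
      by (rule interlaced_rep_within[OF st]) (use step in auto)
  qed
  have "interlaced_rep N (A p) (V p (K p)) (E p (K p))" if "a - 1 \<le> p" "p \<le> b" for p
    using that(2,1)
  proof (induction p rule: int_le_induct)
    case base
    have "V b (K b) = (\<lambda>_. 1)" "E b (K b) = (\<lambda>_. 1)"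
      unfolding V_def E_last by auto
    thus ?case
      using interlaced_rep_base[OF _ N] adj[of b] empty by simp
  next
    case (step p)
    hence rep: "interlaced_rep N (A p) (V p 1) (E p 1)"
      using within K by simp
    have V: "V (p - 1) (K (p - 1)) = (\<lambda>m. \<Sum>n | n \<in> tuples N (A p) \<and> tri_lt (A (p - 1)) m (A p) n.
        (\<Prod>j\<in>A p. 1 / of_int (n j)) * V p 1 n)"
    proof
      fix m
      \<comment> \<open>One of the \<open>K p\<close> factors is spent on crossing to diagonal
        \<open>p - 1\<close>; the other \<open>K p - 1\<close> were spent inside diagonal
        \<open>p\<close>.\<close>
      have "w p n = (\<Prod>j\<in>A p. 1 / of_int (n j)) * (\<Prod>j\<in>A p. 1 / of_int (n j)) ^ (K p - 1)" for n
        unfolding w_def using K[of p] by (simp add: power_eq_if)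
      moreover have "[p - 1 + 1..b] = p # [p + 1..b]"
        using step by (simp add: upto_rec1)
      ultimately show "V (p - 1) (K (p - 1)) m = (\<Sum>n | n \<in> tuples N (A p) \<and> tri_lt (A (p - 1)) m (A p) n.
          (\<Prod>j\<in>A p. 1 / of_int (n j)) * V p 1 n)"
        unfolding V_def by (simp add: X_def R_def mult.assoc)
    qed
    have E: "E (p - 1) (K (p - 1)) = (\<lambda>c. \<Sum>n | n \<in> tuples N (A p) \<and> tri_lt (A (p - 1)) c (A p) n.
        (\<Prod>j\<in>A p. 1 / of_int (int N - n j)) * E p 1 n)"
    proof
      fix c
      have "levels K (p - 1 + 1) b = (p, 1) # map (Pair p) [Suc 1..<Suc (K p)] @ levels K (p + 1) b"
        using step K[of p] by (simp add: levels_rec upt_conv_Cons del: upt_Suc)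
      moreover have "R' (p - 1, K (p - 1)) (p, 1) = (\<lambda>m n. tri_lt (A (p - 1)) m (A p) n)"
        "X' (p, 1) = tuples N (A p)" "w' (p, 1) = (\<lambda>n. \<Prod>j\<in>A p. 1 / of_int (int N - n j))"
        by (auto simp: R'_def X'_def w'_def)
      ultimately show "E (p - 1) (K (p - 1)) c = (\<Sum>n | n \<in> tuples N (A p) \<and> tri_lt (A (p - 1)) c (A p) n.
          (\<Prod>j\<in>A p. 1 / of_int (int N - n j)) * E p 1 n)"
        unfolding E_last E_def by simp
    qed
    show ?case unfolding V E
      by (rule interlaced_rep_step[OF _ N rep]) (use adj[of "p - 1"] in simp)
  qed
  from this[of "a - 1"] have "interlaced_rep N {} (V (a - 1) 1) (E (a - 1) 1)"
    using ab empty Ka by simp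
  hence "V (a - 1) 1 (\<lambda>_. undefined) = E (a - 1) 1 (\<lambda>_. undefined)"
    by (rule interlaced_rep_empty)
  thus ?thesis
    unfolding V_def E_def using Ka empty by simp
qed

section \<open>Diagonals of skew diagrams\<close>

lemma finite_skew_diagram:
  assumes "skew_diagram D"
  shows "finite D"
proof -
  from assms obtain la mu where la: "finite {i::nat. la i \<noteq> (0::nat)}" and D: "D = skew_cells la mu"
    unfolding skew_diagram_def is_partition_def by blast
  have "D \<subseteq> (\<lambda>(i, j). (int i + 1, int j)) ` (SIGMA i:{i. la i \<noteq> 0}. {mu i<..la i})"
    unfolding D skew_cells_def by (force simp: image_iff)
  thus ?thesis
    using la by (rule_tac finite_subset) auto
qed

text \<open>Monotonicity of both partitions gives
  \<open>mu c \<le> mu a < b \<le> d \<le> b' \<le> la a' \<le> la c\<close>.\<close>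

lemma skew_diagram_convex:
  assumes "skew_diagram D" "(i, j) \<in> D" "(i', j') \<in> D" "i \<le> x" "x \<le> i'" "j \<le> y" "y \<le> j'"
  shows "(x, y) \<in> D"
proof -
  from assms(1) obtain la mu where la: "decseq la" and mu: "decseq mu"
    and D: "D = skew_cells la mu"
    unfolding skew_diagram_def is_partition_def by blast
  from assms(2) obtain a b where ab: "i = int a + 1" "j = int b" "mu a < b" "b \<le> la a"
    unfolding D skew_cells_def by blast
  from assms(3) obtain a' b' where ab': "i' = int a' + 1" "j' = int b'" "mu a' < b'" "b' \<le> la a'"
    unfolding D skew_cells_def by blast
  define c d where "c = nat (x - 1)" and "d = nat y"
  have cd: "x = int c + 1" "y = int d"
    using assms(4,6) ab by (auto simp: c_def d_def)
  have le: "a \<le> c" "c \<le> a'" "b \<le> d" "d \<le> b'"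
    using assms(4-7) ab ab' cd by auto
  have "mu c < d" "d \<le> la c"
    using decseqD[OF mu le(1)] decseqD[OF la le(2)] le ab ab' by auto
  thus ?thesis
    unfolding D skew_cells_def using cd by blast
qed

lemma J_iff: "j \<in> J D p \<longleftrightarrow> (j + p, j) \<in> D"
  by (simp add: J_def)

lemma diag_eq_empty_iff: "diag D p = {} \<longleftrightarrow> J D p = {}"
proof -
  have "(\<exists>i j. (i, j) \<in> D \<and> i - j = p) \<longleftrightarrow> (\<exists>j. (j + p, j) \<in> D)"
    by (metis add.commute add_diff_cancel_left' diff_add_cancel)
  thus ?thesis
    by (auto simp: diag_def J_def)
qed

lemma finite_J:
  assumes "finite D"
  shows "finite (J D p)"
proof (rule finite_subset)
  show "J D p \<subseteq> snd ` D"
    by (force simp: J_def)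
  show "finite (snd ` D)"
    using assms by simp
qed

lemma convex_int_set_eq:
  fixes S :: "int set"
  assumes "finite S" "S \<noteq> {}" "\<And>a b c. a \<in> S \<Longrightarrow> c \<in> S \<Longrightarrow> a \<le> b \<Longrightarrow> b \<le> c \<Longrightarrow> b \<in> S"
  shows "S = {Min S..<Max S + 1}"
proof
  show "S \<subseteq> {Min S..<Max S + 1}"
    using assms(1) by (auto simp: zle_add1_eq_le)
  show "{Min S..<Max S + 1} \<subseteq> S"
  proof
    fix x assume x: "x \<in> {Min S..<Max S + 1}"
    show "x \<in> S"
      by (rule assms(3)[OF Min_in[OF assms(1,2)] Max_in[OF assms(1,2)]]) (use x in auto)
  qed
qed

text \<open>Everything follows from convexity: cells of one diagonal form an interval, and cells on
  neighbouring diagonals force the cells that compare the end points.\<close>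

lemma adjacent_J:
  assumes "skew_diagram D"
  shows "adjacent (J D p) (J D (p + 1))"
proof -
  let ?A = "J D p" and ?B = "J D (p + 1)"
  note conv = skew_diagram_convex[OF assms]
  have fin: "finite ?A" "finite ?B"
    using finite_J finite_skew_diagram[OF assms] by auto
  have int: "b \<in> J D q" if "a \<in> J D q" "c \<in> J D q" "a \<le> b" "b \<le> c" for a b c q
    using conv[of "a + q" a "c + q" c "b + q" b] that by (simp add: J_iff)
  have A: "?A = {Min ?A..<Max ?A + 1}" "Min ?A \<le> Max ?A" if "?A \<noteq> {}"
    using convex_int_set_eq[OF fin(1) that int] that fin by auto
  have B: "?B = {Min ?B..<Max ?B + 1}" "Min ?B \<le> Max ?B" if "?B \<noteq> {}"
    using convex_int_set_eq[OF fin(2) that int] that fin by auto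
  have below: "a - 1 \<in> ?B" if "a \<in> ?A" "b \<in> ?B" "b \<le> a - 1" for a b
    using conv[of "b + (p + 1)" b "a + p" a "a - 1 + (p + 1)" "a - 1"] that by (simp add: J_iff)
  have up: "b + 1 \<in> ?A" if "a \<in> ?A" "b \<in> ?B" "b + 1 \<le> a" for a b
    using conv[of "b + (p + 1)" b "a + p" a "b + 1 + p" "b + 1"] that by (simp add: J_iff)
  have down: "a \<in> ?B" if "a \<in> ?A" "b \<in> ?B" "a \<le> b" for a b
    using conv[of "a + p" a "b + (p + 1)" b "a + (p + 1)" a] that by (simp add: J_iff)
  have left: "b \<in> ?A" if "a \<in> ?A" "b \<in> ?B" "a \<le> b" for a b
    using conv[of "a + p" a "b + (p + 1)" b "b + p" b] that by (simp add: J_iff)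
  \<comment> \<open>Two cells of a diagonal span a square that meets both neighbouring diagonals, so
    next to an empty diagonal there is at most one cell.\<close>
  have pairA: "?B \<noteq> {}" if "a \<in> ?A" "b \<in> ?A" "a < b" for a b
    using conv[of "a + p" a "b + p" b "a + (p + 1)" a] that by (auto simp: J_iff)
  have pairB: "?A \<noteq> {}" if "a \<in> ?B" "b \<in> ?B" "a < b" for a b
    using conv[of "a + (p + 1)" a "b + (p + 1)" b "b + p" b] that by (auto simp: J_iff)
  show ?thesis
  proof (cases "?A = {}"; cases "?B = {}")
    assume "?A = {}" "?B = {}"
    thus ?thesis
      unfolding adjacent_def by (intro exI[of _ 0]) auto
  next
    assume e: "?A = {}" "?B \<noteq> {}"
    have "Min ?B = Max ?B"
      using e B[OF e(2)] pairB[of "Min ?B" "Max ?B"] Min_in[OF fin(2) e(2)] Max_in[OF fin(2) e(2)] by fastforce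
    hence "?B = {Min ?B..<Min ?B + 1}" using B[OF e(2)] by metis
    thus ?thesis
      unfolding adjacent_def using e
      by (intro exI[of _ "Min ?B + 1"] exI[of _ "Min ?B + 1"] exI[of _ "Min ?B"] exI[of _ "Min ?B + 1"]) auto
  next
    assume e: "?A \<noteq> {}" "?B = {}"
    have "Min ?A = Max ?A"
      using e A[OF e(1)] pairA[of "Min ?A" "Max ?A"] Min_in[OF fin(1) e(1)] Max_in[OF fin(1) e(1)] by fastforce
    hence "?A = {Min ?A..<Min ?A + 1}" using A[OF e(1)] by metis
    thus ?thesis
      unfolding adjacent_def using e
      by (intro exI[of _ "Min ?A"] exI[of _ "Min ?A + 1"] exI[of _ "Min ?A"] exI[of _ "Min ?A"]) auto
  next
    assume e: "?A \<noteq> {}" "?B \<noteq> {}"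
    note mem = Min_in[OF fin(1) e(1)] Max_in[OF fin(1) e(1)] Min_in[OF fin(2) e(2)] Max_in[OF fin(2) e(2)]
    have 1: "Min ?A - 1 \<le> Min ?B"
      using up[OF mem(1) mem(3)] Min_le[OF fin(1), of "Min ?B + 1"] by linarith
    have 2: "Min ?B \<le> Min ?A"
      using down[OF mem(1) mem(3)] Min_le[OF fin(2), of "Min ?A"] by linarith
    have 3: "Max ?A - 1 \<le> Max ?B"
      using below[OF mem(2) mem(4)] Max_ge[OF fin(2), of "Max ?A - 1"] by linarith
    have 4: "Max ?B \<le> Max ?A"
      using left[OF mem(2) mem(4)] Max_ge[OF fin(1), of "Max ?B"] by linarith
    show ?thesis
      unfolding adjacent_def using A[OF e(1)] B[OF e(2)] 1 2 3 4
      by (intro exI[of _ "Min ?A"] exI[of _ "Max ?A + 1"] exI[of _ "Min ?B"] exI[of _ "Max ?B + 1"]) simp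
  qed
qed

lemma finite_diagonals:
  assumes "finite D"
  shows "finite {p. diag D p \<noteq> {}}"
proof (rule finite_subset)
  show "{p. diag D p \<noteq> {}} \<subseteq> (\<lambda>(i, j). i - j) ` D"
    by (force simp: diag_def)
qed (use assms in simp)

lemma J_outside:
  assumes "finite D" "p < p_min D \<or> p_max D < p"
  shows "J D p = {}"
proof (rule ccontr)
  assume "J D p \<noteq> {}"
  hence "p \<in> {p. diag D p \<noteq> {}}"
    by (simp add: diag_eq_empty_iff)
  thus False
    using assms finite_diagonals[OF assms(1)] Min_le Max_ge
    unfolding p_min_def p_max_def by (metis (no_types, lifting) not_less)
qed

lemma p_range:
  assumes "finite D" "(i, j) \<in> D"
  shows "i - j \<in> {p_min D..p_max D}"
proof -
  have "j \<in> J D (i - j)"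
    using assms(2) by (simp add: J_iff)
  thus ?thesis
    using J_outside[OF assms(1), of "i - j"] by fastforce
qed

lemma diag_index_eq:
  assumes "diag_const D k" "(i, j) \<in> D"
  shows "diag_index D k (i - j) = k (i, j)"
proof -
  have ne: "(i, j) \<in> diag D (i - j)"
    using assms(2) by (simp add: diag_def)
  obtain i' j' where c: "(SOME c. c \<in> diag D (i - j)) = (i', j')"
    by (cases "SOME c. c \<in> diag D (i - j)")
  have "(i', j') \<in> diag D (i - j)"
    using someI[of "\<lambda>c. c \<in> diag D (i - j)", OF ne] c by simp
  hence "k (i', j') = k (i, j)"
    using assms(1)[unfolded diag_const_def, rule_format, of i' j' i j] assms(2)
    by (auto simp: diag_def)
  thus ?thesis
    using ne c by (auto simp: diag_index_def)
qed

lemma diag_index_pos: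
  assumes "is_index D k"
  shows "1 \<le> diag_index D k p"
proof (cases "diag D p = {}")
  case False
  hence "(SOME c. c \<in> diag D p) \<in> diag D p"
    by (simp add: some_in_eq)
  hence "(SOME c. c \<in> diag D p) \<in> D"
    by (auto simp: diag_def)
  thus ?thesis
    using assms False by (simp add: diag_index_def is_index_def Suc_le_eq)
qed (simp add: diag_index_def)

section \<open>Both zeta values as sums over chains\<close>

lemma prod_cells_by_diagonals:
  fixes f :: "int \<Rightarrow> int \<Rightarrow> real"
  assumes "finite D"
  shows "(\<Prod>(i, j)\<in>D. f (i - j) j) = (\<Prod>p\<in>{p_min D..p_max D}. \<Prod>j\<in>J D p. f p j)"
proof -
  have "(\<Prod>p\<in>{p_min D..p_max D}. \<Prod>j\<in>J D p. f p j) =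
      (\<Prod>(p, j)\<in>(SIGMA p:{p_min D..p_max D}. J D p). f p j)"
    using finite_J[OF assms] by (intro prod.Sigma) auto
  also have "\<dots> = (\<Prod>(i, j)\<in>D. f (i - j) j)"
    using p_range[OF assms]
    by (intro prod.reindex_bij_witness[of _ "\<lambda>(i, j). (i - j, j)" "\<lambda>(p, j). (j + p, j)"])
       (auto simp: J_iff)
  finally show ?thesis ..
qed

text \<open>A filling is cut into its diagonals, each indexed by columns. The column condition
  becomes the strict half of \<open>tri_lt\<close>, the row condition the weak half.\<close>

lemma zeta_lt_eq_sum_diagonals:
  assumes "finite D" "diag_const D k"
  defines "P \<equiv> {p_min D..p_max D}"
  shows "zeta_lt N D k =
    (\<Sum>n | n \<in> Pi\<^sub>E P (\<lambda>p. tuples N (J D p)) \<and>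
        (\<forall>p\<in>{p_min D..<p_max D}. tri_lt (J D p) (n p) (J D (p + 1)) (n (p + 1))).
      \<Prod>p\<in>P. (\<Prod>j\<in>J D p. 1 / of_int (n p j)) ^ diag_index D k p)"
  unfolding zeta_lt_def
proof (rule sum.reindex_bij_witness[where j = "\<lambda>m. \<lambda>p\<in>P. \<lambda>j\<in>J D p. m (j + p, j)"
      and i = "\<lambda>n. \<lambda>(i, j)\<in>D. n (i - j) j"])
  fix m assume m: "m \<in> SSYT N D"
  let ?n = "\<lambda>p\<in>P. \<lambda>j\<in>J D p. m (j + p, j)"
  have n: "?n (i - j) j = m (i, j)" if "(i, j) \<in> D" for i j
    using p_range[OF assms(1) that] that by (simp add: P_def J_iff)
  show "(\<lambda>(i, j)\<in>D. ?n (i - j) j) = m"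
    using m n by (auto simp: SSYT_def PiE_def extensional_def fun_eq_iff)
  show "?n \<in> {n. n \<in> Pi\<^sub>E P (\<lambda>p. tuples N (J D p)) \<and>
      (\<forall>p\<in>{p_min D..<p_max D}. tri_lt (J D p) (n p) (J D (p + 1)) (n (p + 1)))}"
  proof (intro CollectI conjI ballI)
    have "m c \<in> {1..int N - 1}" if "c \<in> D" for c
      using m that unfolding SSYT_def by blast
    thus "?n \<in> Pi\<^sub>E P (\<lambda>p. tuples N (J D p))"
      by (auto simp: tuples_def J_iff)
    fix p assume p: "p \<in> {p_min D..<p_max D}"
    have "m (j + p, j) < m (j + (p + 1), j)" if "j \<in> J D p" "j \<in> J D (p + 1)" for j
    proof -
      have "(j + p, j) \<in> D" "(j + p + 1, j) \<in> D"
        using that by (simp_all add: J_iff add.assoc)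
      hence "m (j + p, j) < m (j + p + 1, j)"
        using m unfolding SSYT_def by blast
      thus ?thesis by (simp add: add.assoc)
    qed
    moreover have "m (j - 1 + (p + 1), j - 1) \<le> m (j + p, j)" if "j \<in> J D p" "j - 1 \<in> J D (p + 1)" for j
    proof -
      have "(j + p, j - 1) \<in> D" "(j + p, j - 1 + 1) \<in> D"
        using that by (simp_all add: J_iff)
      hence "m (j + p, j - 1) \<le> m (j + p, j - 1 + 1)"
        using m unfolding SSYT_def by blast
      thus ?thesis by simp
    qed
    ultimately show "tri_lt (J D p) (?n p) (J D (p + 1)) (?n (p + 1))"
      using p by (simp add: tri_lt_def P_def)
  qed
  have "(\<Prod>p\<in>P. (\<Prod>j\<in>J D p. 1 / of_int (?n p j)) ^ diag_index D k p) =
      (\<Prod>p\<in>P. \<Prod>j\<in>J D p. 1 / of_int (?n p j) ^ diag_index D k p :: real)"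
    by (simp add: prod_power_distrib power_one_over)
  also have "\<dots> = (\<Prod>(i, j)\<in>D. 1 / of_int (?n (i - j) j) ^ diag_index D k (i - j))"
    unfolding P_def using prod_cells_by_diagonals[OF assms(1)] by (rule sym)
  also have "\<dots> = (\<Prod>c\<in>D. 1 / of_int (m c) ^ k c)"
    using n diag_index_eq[OF assms(2)] by (intro prod.cong refl) auto
  finally show "(\<Prod>p\<in>P. (\<Prod>j\<in>J D p. 1 / of_int (?n p j)) ^ diag_index D k p) =
      (\<Prod>c\<in>D. 1 / of_int (m c) ^ k c :: real)" .
next
  fix n assume "n \<in> {n. n \<in> Pi\<^sub>E P (\<lambda>p. tuples N (J D p)) \<and>
      (\<forall>p\<in>{p_min D..<p_max D}. tri_lt (J D p) (n p) (J D (p + 1)) (n (p + 1)))}"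
  hence n: "n \<in> Pi\<^sub>E P (\<lambda>p. tuples N (J D p))"
    and tri: "\<And>p. p \<in> {p_min D..<p_max D} \<Longrightarrow> tri_lt (J D p) (n p) (J D (p + 1)) (n (p + 1))"
    by auto
  let ?m = "\<lambda>(i, j)\<in>D. n (i - j) j"
  have np: "n p \<in> J D p \<rightarrow>\<^sub>E {1..int N - 1}" if "p \<in> P" for p
    using n that unfolding tuples_def by blast
  show "(\<lambda>p\<in>P. \<lambda>j\<in>J D p. ?m (j + p, j)) = n"
  proof
    fix p show "(\<lambda>p\<in>P. \<lambda>j\<in>J D p. ?m (j + p, j)) p = n p"
    proof (cases "p \<in> P")
      case True
      thus ?thesis
        using np[OF True] by (auto simp: fun_eq_iff J_iff PiE_def extensional_def)
    next
      case False
      thus ?thesis using n by (auto simp: PiE_def extensional_def)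
    qed
  qed
  show "?m \<in> SSYT N D"
    unfolding SSYT_def
  proof (intro CollectI conjI allI impI)
    have "n (i - j) j \<in> {1..int N - 1}" if "(i, j) \<in> D" for i j
    proof -
      have "j \<in> J D (i - j)" using that by (simp add: J_iff)
      thus ?thesis
        using np[of "i - j"] p_range[OF assms(1) that] unfolding P_def by blast
    qed
    thus "?m \<in> D \<rightarrow>\<^sub>E {1..int N - 1}" by auto
  next
    fix i j assume ij: "(i, j) \<in> D" "(i, j + 1) \<in> D"
    \<comment> \<open>The right neighbour lies on the diagonal with the smaller number, so the weak
      inequality runs from \<open>?p + 1\<close> back to \<open>?p\<close>.\<close>
    let ?p = "i - (j + 1)"
    have "?p \<in> {p_min D..<p_max D}"
      using p_range[OF assms(1) ij(1)] p_range[OF assms(1) ij(2)] by auto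
    moreover have "j + 1 \<in> J D ?p" "j + 1 - 1 \<in> J D (?p + 1)"
      using ij by (simp_all add: J_iff)
    ultimately have "n (?p + 1) (j + 1 - 1) \<le> n ?p (j + 1)"
      using tri unfolding tri_lt_def by blast
    moreover have "?p + 1 = i - j" by simp
    ultimately show "?m (i, j) \<le> ?m (i, j + 1)"
      using ij by simp
  next
    fix i j assume ij: "(i, j) \<in> D" "(i + 1, j) \<in> D"
    let ?p = "i - j"
    have "?p \<in> {p_min D..<p_max D}"
      using p_range[OF assms(1) ij(1)] p_range[OF assms(1) ij(2)] by auto
    moreover have "j \<in> J D ?p \<inter> J D (?p + 1)"
      using ij by (simp add: J_iff add.commute)
    ultimately have "n ?p j < n (?p + 1) j"
      using tri unfolding tri_lt_def by blast
    moreover have "?p + 1 = i + 1 - j" by simp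
    ultimately show "?m (i, j) < ?m (i + 1, j)"
      using ij by simp
  qed
qed

lemma zeta_flat_eq_sum_levels:
  assumes K: "\<And>p. 1 \<le> diag_index D k p"
  shows "zeta_flat N D k =
    (\<Sum>n\<in>flat_families N D k. \<Prod>(p, l)\<in>(SIGMA p:{p_min D..p_max D}. {1..diag_index D k p}).
      if l = 1 then \<Prod>j\<in>J D p. 1 / of_int (int N - n (p, l) j) else \<Prod>j\<in>J D p. 1 / of_int (n (p, l) j))"
  unfolding zeta_flat_def
proof (intro sum.cong refl)
  fix n :: "int \<times> nat \<Rightarrow> int \<Rightarrow> int"
  let ?P = "{p_min D..p_max D}" and ?K = "diag_index D k"
  let ?w = "\<lambda>p l. (if l = 1 then \<Prod>j\<in>J D p. 1 / of_int (int N - n (p, l) j)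
    else \<Prod>j\<in>J D p. 1 / of_int (n (p, l) j)) :: real"
  have "(\<Prod>l\<in>{1..?K p}. ?w p l) = 1 / ((\<Prod>j\<in>J D p. of_int (int N - n (p, 1) j)) *
      (\<Prod>l\<in>{2..?K p}. \<Prod>j\<in>J D p. of_int (n (p, l) j)))" for p
  proof -
    have split: "{1..?K p} = insert 1 {2..?K p}"
      using K[of p] by auto
    have "(\<Prod>l\<in>{2..?K p}. ?w p l) = (\<Prod>l\<in>{2..?K p}. 1 / (\<Prod>j\<in>J D p. of_int (n (p, l) j)))"
      by (intro prod.cong refl) (auto simp: prod_dividef)
    thus ?thesis
      unfolding split by (simp add: prod_dividef)
  qed
  moreover have "(\<Prod>(p, l)\<in>(SIGMA p:?P. {1..?K p}). ?w p l) = (\<Prod>p\<in>?P. \<Prod>l\<in>{1..?K p}. ?w p l)"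
    by (rule prod.Sigma[symmetric]) auto
  ultimately show "(\<Prod>p\<in>?P. 1 / ((\<Prod>j\<in>J D p. of_int (int N - n (p, 1) j)) *
      (\<Prod>l\<in>{2..?K p}. \<Prod>j\<in>J D p. of_int (n (p, l) j)))) = (\<Prod>(p, l)\<in>(SIGMA p:?P. {1..?K p}). ?w p l)"
    by simp
qed

theorem theorem3p6:
  fixes D :: "cell set" and k :: "cell \<Rightarrow> nat" and N :: nat
  assumes "skew_diagram D" and "D \<noteq> {}"
    and "is_index D k" and "diag_const D k"
    and "N \<ge> 1"
  shows "zeta_lt N D k = zeta_flat N D k"
proof -
  note finD = finite_skew_diagram[OF assms(1)]
  define a b K A where "a = p_min D" and "b = p_max D" and "K = diag_index D k" and "A = J D"
  define R where "R = (\<lambda>p q m n. tri_lt (A p) m (A q) n)"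
  define R' where "R' = (\<lambda>(p, l :: nat) (q, l' :: nat) m n.
    if p = q then tri_le (A p) m (A p) n else tri_lt (A p) m (A q) n)"
  have K: "1 \<le> K p" for p
    unfolding K_def by (rule diag_index_pos[OF assms(3)])
  have empty: "A (a - 1) = {}" "A (b + 1) = {}"
    unfolding A_def a_def b_def using J_outside[OF finD] by auto
  obtain i j where "(i, j) \<in> D" using assms(2) by auto
  hence ab: "a \<le> b" using p_range[OF finD] unfolding a_def b_def by force
  \<comment> \<open>The convention for empty diagonals provides a starting position with the single
    level 1.\<close>
  have Ka: "K (a - 1) = 1"
    using empty(1) by (simp add: K_def A_def diag_index_def diag_eq_empty_iff)
  have finA: "finite (A p)" for p
    unfolding A_def by (rule finite_J[OF finD])
  let ?w = "\<lambda>p m. (\<Prod>j\<in>A p. 1 / of_int (m j)) ^ K p :: real"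
  let ?w' = "\<lambda>(p, l) n. if l = (1::nat) then \<Prod>j\<in>A p. 1 / of_int (int N - n j)
    else \<Prod>j\<in>A p. 1 / of_int (n j) :: real"
  let ?X = "\<lambda>p. tuples N (A p)" and ?X' = "\<lambda>(p, l :: nat). tuples N (A p)"
  let ?u = "\<lambda>_ :: int. undefined :: int"

  have left: "zeta_lt N D k = chain_sum ?X R ?w (a - 1) ?u [a..b]"
  proof -
    \<comment> \<open>The diagonal \<open>a - 1\<close> is empty, so \<open>?u\<close> is its only
      tuple and its link to diagonal \<open>a\<close> is vacuous.\<close>
    have "successively (\<lambda>p q. R p q ((n(a - 1 := ?u)) p) ((n(a - 1 := ?u)) q)) ((a - 1) # [a..b]) \<longleftrightarrow>
        (\<forall>p\<in>{a..<b}. tri_lt (A p) (n p) (A (p + 1)) (n (p + 1)))" for n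
    proof -
      have "successively (\<lambda>p q. R p q ((n(a - 1 := ?u)) p) ((n(a - 1 := ?u)) q)) [a..b] \<longleftrightarrow>
          successively (\<lambda>p q. R p q (n p) (n q)) [a..b]"
        by (intro successively_cong) auto
      thus ?thesis
        using empty ab by (simp add: successively_Cons successively_upto R_def tri_lt_def)
    qed
    thus ?thesis
      using zeta_lt_eq_sum_diagonals[OF finD assms(4), of N] finA
      by (subst chain_sum_eq) (simp_all add: a_def b_def K_def A_def del: successively.simps)
  qed

  have right: "zeta_flat N D k = chain_sum ?X' R' ?w' (a - 1, 1) ?u (levels K a b)"
  proof -
    have cond: "successively (\<lambda>p q. R' p q ((n((a - 1, 1) := ?u)) p) ((n((a - 1, 1) := ?u)) q))
          ((a - 1, 1) # levels K a b) \<longleftrightarrow>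
        (\<forall>p\<in>{a..b}. \<forall>l\<in>{1..<K p}. tri_le (A p) (n (p, l)) (A p) (n (p, l + 1))) \<and>
        (\<forall>p\<in>{a..<b}. tri_lt (A p) (n (p, K p)) (A (p + 1)) (n (p + 1, 1)))" for n
    proof -
      have "successively (\<lambda>p q. R' p q ((n((a - 1, 1) := ?u)) p) ((n((a - 1, 1) := ?u)) q)) (levels K a b) \<longleftrightarrow>
          successively (\<lambda>p q. R' p q (n p) (n q)) (levels K a b)"
        by (intro successively_cong) (auto simp: set_levels)
      moreover have "R' (a - 1, 1) (hd (levels K a b)) m m'" for m m'
        using hd_levels[OF ab K] empty by (simp add: R'_def tri_lt_def)
      ultimately show ?thesis
        unfolding successively_Cons successively_levels[OF K]
        using hd_levels[OF ab K] by (simp add: R'_def)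
    qed
    have fam: "flat_families N D k = {n. n \<in> Pi\<^sub>E (set (levels K a b)) ?X' \<and>
        (\<forall>p\<in>{a..b}. \<forall>l\<in>{1..<K p}. tri_le (A p) (n (p, l)) (A p) (n (p, l + 1))) \<and>
        (\<forall>p\<in>{a..<b}. tri_lt (A p) (n (p, K p)) (A (p + 1)) (n (p + 1, 1)))}"
      unfolding flat_families_def set_levels tuples_def a_def b_def K_def A_def ..
    have dist: "distinct ((a - 1, 1) # levels K a b)"
      using distinct_levels by (auto simp: set_levels)
    have zeta: "zeta_flat N D k = (\<Sum>n\<in>flat_families N D k. \<Prod>i\<in>set (levels K a b). ?w' i (n i))"
      unfolding zeta_flat_eq_sum_levels[OF K[unfolded K_def]] set_levels a_def b_def K_def A_def
      by (intro sum.cong prod.cong refl) auto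
    have fin: "finite (?X' i)" for i
      using finA by (simp add: case_prod_unfold)
    show ?thesis
      unfolding chain_sum_eq[OF dist fin] cond zeta fam ..
  qed

  have adj: "adjacent (A p) (A (p + 1))" for p
    unfolding A_def by (rule adjacent_J[OF assms(1)])
  show ?thesis
    unfolding left right R_def R'_def
    by (rule chain_sum_duality[where A = A and K = K and N = N, OF _ K adj empty _ Ka]) (use assms(5) ab in auto)
qed

end
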